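(* Let $1\le k\le n\le m_L\le J$, and let $\mathcal{C}_1$ and $\mathcal{C}_2$ be $(J\times n,q^{Jk},d)$ circular-shift-based MRD codes with the same exponents $l_0,\dots,l_{n-1}$, where $\mathbf{H}_L=[\mathbf{I}_J~\mathbf{0}]^{\mathrm T}$ is set in the definition of $\mathcal{C}_1$ and $\mathbf{G}_L=[\mathbf{I}_J~\mathbf{0}]$ is set in the definition of $\mathcal{C}_2$. For $1\le i,s\le J/m_L$ let $$\mathcal{B}_{i,s}=[\beta^{(i-1)m_L(L-\varepsilon_s)}~\beta^{((i-1)m_L+1)(L-\varepsilon_s)}~\ldots~\beta^{(im_L-1)(L-\varepsilon_s)}],\qquad \mathcal{F}_s=\{\beta^{\varepsilon_sl_0},\beta^{\varepsilon_sl_1},\ldots,\beta^{\varepsilon_sl_{n-1}}\}$$ (each $\mathcal{B}_{i,s}$ is a basis of $\mathbb{F}_{q^{m_L}}$ over $\mathbb{F}_q$, and each $\mathcal{F}_s$, taken in the listed order, consists of $n$ $\mathbb{F}_q$-linearly independent elements), and let $\widetilde{\mathcal{M}}\subseteq\mathbb{F}_q^{J\times n}$ be the rank-metric code defined from the $\mathcal{B}_{i,s}$ and $\mathcal{F}_s$. Then $$\mathcal{C}_1=\mathcal{C}_2=\widetilde{\mathcal{M}}.$$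
   Context: Setting. $q$ is a prime, $L$ is a positive integer with $\gcd(q,L)=1$, $m_L$ is the multiplicative order of $q$ modulo $L$, $\mathcal{J}=\{j:1\le j\le L-1,\ \gcd(j,L)=1\}$, $J=|\mathcal{J}|$, and $m_L\le J$ (automatic for $L\ge 2$). $L_{\mathbb{F}_q}=L \bmod q$ is regarded as a nonzero element of $\mathbb{F}_q$. $\beta\in\mathbb{F}_{q^{m_L}}$ is a primitive $L$-th root of unity. $\mathbf{C}_L=\begin{bmatrix}\mathbf{0}&\mathbf{I}_{L-1}\\1&\mathbf{0}\end{bmatrix}$ is the $L\times L$ cyclic permutation matrix over $\mathbb{F}_q$. $\mathbf{V}_L=[\beta^{ij}]_{0\le i,j\le L-1}$ and $\widetilde{\mathbf{V}}_L=[\beta^{-ij}]_{0\le i,j\le L-1}$. $[\mathbf{x}_j]_{j\in\mathcal{J}}$ denotes juxtaposition of columns in increasing order of $j$; $j\notin\mathcal J$ means $0\le j\le L-1$, $j\notin\mathcal{J}$. $\tau(x)=\prod_{0\le j\le L-1,\,j\notin\mathcal{J}}(x-\beta^j)\in\mathbb{F}_q[x]$. The set $\mathcal{J}$ is partitioned as $\mathcal{J}_1\cup\dots\cup\mathcal{J}_{J/m_L}$, where each $\mathcal{J}_s$ has $m_L$ elements and is closed under multiplication by $q$ modulo $L$; $\varepsilon_s$ is a fixed element of $\mathcal{J}_s$, so $\mathcal{J}_s=\{\varepsilon_sq^j\bmod L:0\le j\le m_L-1\}$. $\mathbf{U}=[\mathbf{u}_j]_{0\le j\le L-1}$ and $\mathbf{U}'=[\mathbf{u}'_j]_{0\le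 j\le L-1}$ are matrices in $\mathbb{F}_{q^{m_L}}^{J\times L}$ (columns indexed from $0$) satisfying: $\mathrm{rank}([\mathbf{u}_j]_{j\in\mathcal{J}})=J$; $[\mathbf{u}'_j]_{j\in\mathcal{J}}^{\mathrm T}=L_{\mathbb{F}_q}^{-1}[\mathbf{u}_j]_{j\in\mathcal{J}}^{-1}$; and $[\mathbf{u}_j]_{j\notin\mathcal{J}}=\mathbf{0}$ or $[\mathbf{u}'_j]_{j\notin\mathcal{J}}=\mathbf{0}$. Put $\mathbf{G}_L=\mathbf{U}\widetilde{\mathbf{V}}_L$ and $\mathbf{H}_L=\mathbf{V}_L\mathbf{U}'^{\mathrm T}$; an admissible pair $(\mathbf{G}_L,\mathbf{H}_L)$ is one obtained this way with all entries in $\mathbb{F}_q$. The admissible pairs used for $\mathcal{C}_1$ and for $\mathcal{C}_2$ may be different. Codes. For $\mathbf{P}\in\mathbb{F}_q^{J\times L}$, $\mathbf{Q}\in\mathbb{F}_q^{L\times J}$ and distinct exponents $0\le l_0,\dots,l_{n-1}\le L-1$, the circular-shift-based rank-metric code is the set of all matrices $[\mathbf{c}_0^{\mathrm T}\ \cdots\ \mathbf{c}_{n-1}^{\mathrm T}]\in\mathbb{F}_q^{J\times n}$ with $\mathbf{c}_i=\sum_{s=0}^{k-1}\mathbf{m}_s\mathbf{P}\mathbf{C}_L^{q^sl_i}\mathbf{Q}$, where $(\mathbf{m}_0,\dots,\mathbf{m}_{k-1})$ ranges over $k$-tuples of row vectors in $\mathbb{F}_q^J$. $\mathcal{C}_1$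 is this code for $\mathbf{P}=\mathbf{G}_L,\mathbf{Q}=\mathbf{H}_L$, and $\mathcal{C}_2$ is this code for $\mathbf{P}=\mathbf{G}_L,\mathbf{Q}=\tau(\mathbf{C}_L)\mathbf{G}_L^{\mathrm T}$. They are called circular-shift-based MRD codes when the exponents satisfy $\mathrm{rank}(\sum_{i=0}^{n-1}a_i\mathbf{P}\mathbf{C}_L^{l_i}\mathbf{Q})=J$ for all nonzero $[a_0,\dots,a_{n-1}]\in\mathbb{F}_q^n$; this is equivalent to $\beta^{jl_0},\dots,\beta^{jl_{n-1}}$ being $\mathbb{F}_q$-linearly independent for every $j\in\mathcal{J}$. The code $\widetilde{\mathcal{M}}$. For a row vector $\mathcal{B}=[\omega_0~\ldots~\omega_{m_L-1}]\in\mathbb{F}_{q^{m_L}}^{m_L}$, let $\mathbf{M}_{\mathbf{o}}(\mathcal{B})=[\omega_r^{q^j}]_{0\le r,j\le m_L-1}$. Given bases $\mathcal{B}_{i,s}$ of $\mathbb{F}_{q^{m_L}}$ over $\mathbb{F}_q$ ($1\le i,s\le J/m_L$) and, for each $s$, an ordered list $\mathcal{F}_s=\{\beta_{s,0},\dots,\beta_{s,n-1}\}$ of $\mathbb{F}_q$-linearly independent elements of $\mathbb{F}_{q^{m_L}}$, define for $\bm{\lambda}=[\lambda_0,\dots,\lambda_{k-1}]\in\mathbb{F}_{q^{m_L}}^k$ the polynomial $L_{\bm{\lambda}}(x)=\sum_{i=0}^{k-1}\lambda_ix^{q^i}$, and, for $\bm{\lambda}_s\in\mathbb{F}_{q^{m_L}}^k$,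 the $m_L\times n$ matrix $\mathbf{L}_{\bm{\lambda}_s}=[L_{\bm{\lambda}_s}(\beta_{s,t})^{q^j}]_{0\le j\le m_L-1,\,0\le t\le n-1}$. Each $\mathcal{M}_{i,s}=\{\mathbf{M}_{\mathbf{o}}(\mathcal{B}_{i,s})\mathbf{L}_{\bm{\lambda}_s}:\bm{\lambda}_s\in\mathbb{F}_{q^{m_L}}^k\}$ is an $(m_L\times n,q^{m_Lk},d)$ Gabidulin code. $\widetilde{\mathcal{M}}$ is the set of all $J\times n$ matrices obtained by stacking vertically, for $i=1,\dots,J/m_L$, the $m_L\times n$ blocks $\sum_{s=1}^{J/m_L}\mathbf{M}_{\mathbf{o}}(\mathcal{B}_{i,s})\mathbf{L}_{\bm{\lambda}_s}$, as $(\bm{\lambda}_1,\dots,\bm{\lambda}_{J/m_L})$ ranges over $(\mathbb{F}_{q^{m_L}}^k)^{J/m_L}$ (the same $\bm{\lambda}_s$ is used in all block rows $i$). *)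

theory Defs
  imports
    "Jordan_Normal_Form.DL_Rank"
    "HOL-Number_Theory.Number_Theory"
    "HOL-Computational_Algebra.Polynomial"
begin

text \<open>
  Everything lives in one finite field \<open>'a\<close> with \<open>q ^ ord L q\<close> elements; the field with \<open>q\<close>
  elements (\<open>q\<close> prime) is its prime subfield. A matrix over the small field is a matrix over \<open>'a\<close>
  whose entries lie in that subfield; its rank is taken over \<open>'a\<close>, which gives the same number as
  the rank over the subfield. Note the argument order of the library constant: \<open>ord L q\<close> is the
  multiplicative order of \<open>q\<close> modulo \<open>L\<close>.
\<close>

definition prime_subfield :: "'a :: field set" where
  "prime_subfield = range of_int"

definition over_prime_subfield :: "'a :: field mat \<Rightarrow> bool" where
  "over_prime_subfield A \<longleftrightarrow> elements_mat A \<subseteq> prime_subfield"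

definition primitive_root_of_unity :: "nat \<Rightarrow> 'a :: field \<Rightarrow> bool" where
  "primitive_root_of_unity L \<beta> \<longleftrightarrow> L > 0 \<and> \<beta> ^ L = 1 \<and> (\<forall>d. 0 < d \<and> d < L \<longrightarrow> \<beta> ^ d \<noteq> 1)"

definition lin_indep_family :: "'a :: field vec \<Rightarrow> bool" where
  "lin_indep_family v \<longleftrightarrow>
     (\<forall>a. (\<forall>i<dim_vec v. a i \<in> prime_subfield) \<and> (\<Sum>i<dim_vec v. a i * v $ i) = 0
        \<longrightarrow> (\<forall>i<dim_vec v. a i = 0))"

definition basis_family :: "'a :: field vec \<Rightarrow> bool" where
  "basis_family v \<longleftrightarrow> lin_indep_family v \<and>
     (\<forall>x. \<exists>a. (\<forall>i<dim_vec v. a i \<in> prime_subfield) \<and> x = (\<Sum>i<dim_vec v. a i * v $ i))"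

text \<open>Sums of matrices; the dimensions are explicit because JNF matrices have no additive zero.\<close>

definition msum :: "nat \<Rightarrow> nat \<Rightarrow> ('i \<Rightarrow> 'a :: comm_monoid_add mat) \<Rightarrow> 'i set \<Rightarrow> 'a mat" where
  "msum nr nc f S = mat nr nc (\<lambda>(i, j). \<Sum>s\<in>S. f s $$ (i, j))"

definition poly_mat :: "'a :: comm_ring_1 poly \<Rightarrow> 'a mat \<Rightarrow> 'a mat" where
  "poly_mat p A = msum (dim_row A) (dim_row A) (\<lambda>i. Polynomial.coeff p i \<cdot>\<^sub>m (A ^\<^sub>m i)) {..degree p}"

definition select_cols :: "'a mat \<Rightarrow> nat set \<Rightarrow> 'a mat" where
  "select_cols A S = mat_of_cols (dim_row A) (map (col A) (sorted_list_of_set S))"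

definition cop_set :: "nat \<Rightarrow> nat set" where
  "cop_set L = {j. 1 \<le> j \<and> j \<le> L - 1 \<and> gcd j L = 1}"

abbreviation cop_card :: "nat \<Rightarrow> nat" where
  "cop_card L \<equiv> card (cop_set L)"

definition cyclic_mat :: "nat \<Rightarrow> 'a :: field mat" where
  "cyclic_mat L = four_block_mat (0\<^sub>m (L - 1) 1) (1\<^sub>m (L - 1)) (1\<^sub>m 1) (0\<^sub>m 1 (L - 1))"

definition V_mat :: "nat \<Rightarrow> 'a :: field \<Rightarrow> 'a mat" where
  "V_mat L \<beta> = mat L L (\<lambda>(i, j). \<beta> ^ (i * j))"

definition V_tilde_mat :: "nat \<Rightarrow> 'a :: field \<Rightarrow> 'a mat" where
  "V_tilde_mat L \<beta> = mat L L (\<lambda>(i, j). inverse (\<beta> ^ (i * j)))"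

definition tau :: "nat \<Rightarrow> 'a :: field \<Rightarrow> 'a poly" where
  "tau L \<beta> = (\<Prod>j\<in>{0..<L} - cop_set L. [:- (\<beta> ^ j), 1:])"

text \<open>The matrix with the identity in its leading square block and zeros elsewhere.\<close>

definition leading_id :: "nat \<Rightarrow> nat \<Rightarrow> 'a :: field mat" where
  "leading_id nr nc = mat nr nc (\<lambda>(i, j). if i = j then 1 else 0)"

definition admissible_pair :: "nat \<Rightarrow> 'a :: field \<Rightarrow> 'a mat \<Rightarrow> 'a mat \<Rightarrow> bool" where
  "admissible_pair L \<beta> G H \<longleftrightarrow>
    (\<exists>U U'. U \<in> carrier_mat (cop_card L) L \<and> U' \<in> carrier_mat (cop_card L) L \<and>
       vec_space.rank (cop_card L) (select_cols U (cop_set L)) = cop_card L \<and>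
       (\<exists>W \<in> carrier_mat (cop_card L) (cop_card L).
          inverts_mat (select_cols U (cop_set L)) W \<and> inverts_mat W (select_cols U (cop_set L)) \<and>
          (select_cols U' (cop_set L))\<^sup>T = inverse (of_nat L) \<cdot>\<^sub>m W) \<and>
       ((\<forall>j<L. j \<notin> cop_set L \<longrightarrow> col U j = 0\<^sub>v (cop_card L)) \<or>
        (\<forall>j<L. j \<notin> cop_set L \<longrightarrow> col U' j = 0\<^sub>v (cop_card L))) \<and>
       G = U * V_tilde_mat L \<beta> \<and> H = V_mat L \<beta> * U'\<^sup>T \<and>
       over_prime_subfield G \<and> over_prime_subfield H)"

text \<open>Row vectors are matrices with one row, so that \<open>m s * P * C * Q\<close> can be written as is.\<close>

definition circ_shift_code ::
  "nat \<Rightarrow> nat \<Rightarrow> nat \<Rightarrow> nat \<Rightarrow> (nat \<Rightarrow> nat) \<Rightarrow> 'a :: field mat \<Rightarrow> 'a mat \<Rightarrow> 'a mat set" where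
  "circ_shift_code q L k n l P Q =
    {mat (cop_card L) n (\<lambda>(r, i).
        msum 1 (cop_card L) (\<lambda>s. m s * P * (cyclic_mat L ^\<^sub>m (q ^ s * l i)) * Q) {..<k} $$ (0, r))
     | m. \<forall>s<k. m s \<in> carrier_mat 1 (cop_card L) \<and> over_prime_subfield (m s)}"

definition mrd_exponents ::
  "nat \<Rightarrow> nat \<Rightarrow> (nat \<Rightarrow> nat) \<Rightarrow> 'a :: field mat \<Rightarrow> 'a mat \<Rightarrow> bool" where
  "mrd_exponents L n l P Q \<longleftrightarrow>
    (\<forall>a. (\<forall>i<n. a i \<in> prime_subfield) \<and> (\<exists>i<n. a i \<noteq> 0) \<longrightarrow>
      vec_space.rank (cop_card L)
        (msum (cop_card L) (cop_card L) (\<lambda>i. a i \<cdot>\<^sub>m (P * (cyclic_mat L ^\<^sub>m l i) * Q)) {..<n})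
      = cop_card L)"

text \<open>\<open>C\<close> is an \<open>(nr \<times> n, M, d)\<close> rank-metric code.\<close>

definition rank_metric_code :: "nat \<Rightarrow> nat \<Rightarrow> nat \<Rightarrow> nat \<Rightarrow> 'a :: field mat set \<Rightarrow> bool" where
  "rank_metric_code nr n M d C \<longleftrightarrow>
     (\<forall>A\<in>C. A \<in> carrier_mat nr n \<and> over_prime_subfield A) \<and> card C = M \<and>
     d = Min {vec_space.rank nr (A - B) | A B. A \<in> C \<and> B \<in> C \<and> A \<noteq> B}"

definition circ_shift_mrd_code ::
  "nat \<Rightarrow> nat \<Rightarrow> nat \<Rightarrow> nat \<Rightarrow> (nat \<Rightarrow> nat) \<Rightarrow> 'a :: field mat \<Rightarrow> 'a mat \<Rightarrow> nat \<Rightarrow> bool" where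
  "circ_shift_mrd_code q L k n l P Q d \<longleftrightarrow>
     mrd_exponents L n l P Q \<and>
     rank_metric_code (cop_card L) n (q ^ (cop_card L * k)) d (circ_shift_code q L k n l P Q)"

definition coset_partition :: "nat \<Rightarrow> nat \<Rightarrow> (nat \<Rightarrow> nat set) \<Rightarrow> (nat \<Rightarrow> nat) \<Rightarrow> bool" where
  "coset_partition q L Js \<epsilon> \<longleftrightarrow>
     (\<Union>s\<in>{1..cop_card L div ord L q}. Js s) = cop_set L \<and>
     disjoint_family_on Js {1..cop_card L div ord L q} \<and>
     (\<forall>s\<in>{1..cop_card L div ord L q}.
        card (Js s) = ord L q \<and> (\<forall>j\<in>Js s. (j * q) mod L \<in> Js s) \<and> \<epsilon> s \<in> Js s)"

definition M_o :: "nat \<Rightarrow> 'a :: field vec \<Rightarrow> 'a mat" where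
  "M_o q v = mat (dim_vec v) (dim_vec v) (\<lambda>(r, j). (v $ r) ^ (q ^ j))"

definition lin_poly :: "nat \<Rightarrow> 'a :: field vec \<Rightarrow> 'a poly" where
  "lin_poly q v = (\<Sum>i<dim_vec v. Polynomial.monom (v $ i) (q ^ i))"

definition L_mat :: "nat \<Rightarrow> nat \<Rightarrow> 'a :: field vec \<Rightarrow> 'a vec \<Rightarrow> 'a mat" where
  "L_mat q m F v = mat m (dim_vec F) (\<lambda>(j, t). (poly (lin_poly q v) (F $ t)) ^ (q ^ j))"

text \<open>
  The blocks are indexed from 1: row \<open>\<rho>\<close> of the stacked matrix (counted from 0) is row
  \<open>\<rho> mod m\<close> of block \<open>\<rho> div m + 1\<close>, where \<open>m = ord L q\<close>.
\<close>

definition M_tilde ::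
  "nat \<Rightarrow> nat \<Rightarrow> nat \<Rightarrow> nat \<Rightarrow> (nat \<Rightarrow> nat \<Rightarrow> 'a :: field vec) \<Rightarrow> (nat \<Rightarrow> 'a vec) \<Rightarrow> 'a mat set" where
  "M_tilde q L k n B F =
    {mat (cop_card L) n (\<lambda>(\<rho>, t).
        msum (ord L q) n (\<lambda>s. M_o q (B (\<rho> div ord L q + 1) s) * L_mat q (ord L q) (F s) (\<Lambda> s))
          {1..cop_card L div ord L q} $$ (\<rho> mod ord L q, t))
     | \<Lambda>. \<forall>s\<in>{1..cop_card L div ord L q}. \<Lambda> s \<in> carrier_vec k}"

definition B_fam :: "nat \<Rightarrow> nat \<Rightarrow> 'a :: field \<Rightarrow> (nat \<Rightarrow> nat) \<Rightarrow> nat \<Rightarrow> nat \<Rightarrow> 'a vec" where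
  "B_fam q L \<beta> \<epsilon> i s = vec (ord L q) (\<lambda>r. \<beta> ^ (((i - 1) * ord L q + r) * (L - \<epsilon> s)))"

definition F_fam :: "nat \<Rightarrow> 'a :: field \<Rightarrow> (nat \<Rightarrow> nat) \<Rightarrow> (nat \<Rightarrow> nat) \<Rightarrow> nat \<Rightarrow> 'a vec" where
  "F_fam n \<beta> \<epsilon> l s = vec n (\<lambda>t. \<beta> ^ (\<epsilon> s * l t))"

end

theory Submission
  imports Defs
begin

text \<open>
  The columns of \<open>V_mat L \<beta>\<close> diagonalise the cyclic shift, with the powers \<open>\<beta> ^ j\<close> as eigenvalues.
  In these coordinates all three codes have the same shape: the entry at row \<open>r\<close> and column \<open>i\<close> is
  \<open>\<Sum>s<k. \<Sum>j. v s j * \<beta> ^ (q ^ s * l i * j) * \<beta> ^ (- r * j)\<close>, where \<open>j\<close> ranges over the units modulo \<open>L\<close>.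
  A message \<open>m\<^sub>s\<close> has entries in the prime field exactly when its spectrum \<open>v s\<close> is compatible
  with the Frobenius map, that is \<open>v s (q * j mod L) = v s j ^ q\<close>: the change of coordinates is
  invertible and commutes with Frobenius. Such a spectrum is in turn determined freely by its values
  at one representative of each cyclotomic coset, and these values are the coefficients of the
  linearized polynomials defining \<open>M_tilde\<close>.
\<close>

section \<open>Finite fields: counting arguments and polynomial roots\<close>

text \<open>
  The library proves this only for the class \<^class>\<open>finite_field\<close>, of which the sort
  \<open>{field, finite}\<close> is not known to be a subsort.
\<close>

lemma finite_field_power_card:
  fixes x :: "'a :: {field, finite}"
  shows "x ^ card (UNIV :: 'a set) = x"
proof (cases "x = 0")
  case False
  have "bij_betw ((*) x) (UNIV - {0}) (UNIV - {0})"
    using False by (intro bij_betwI[where g = "\<lambda>y. y / x"]) auto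
  then have "(\<Prod>y\<in>UNIV - {0}. x * y) = \<Prod>(UNIV - {0})"
    by (rule prod.reindex_bij_betw)
  then have "x ^ (card (UNIV :: 'a set) - 1) * \<Prod>(UNIV - {0 :: 'a}) = \<Prod>(UNIV - {0})"
    by (simp add: prod.distrib card_Diff_singleton)
  then have "x ^ (card (UNIV :: 'a set) - 1) = 1"
    by simp
  then have "x ^ Suc (card (UNIV :: 'a set) - 1) = x"
    by simp
  then show ?thesis
    by (simp add: card_gt_0_iff)
qed (simp add: card_gt_0_iff power_0_left)

text \<open>The coefficients form a polynomial of degree below \<open>n\<close>, which has fewer
  than \<open>n\<close> roots unless it is zero. This takes the place of a Vandermonde determinant
  in the later independence arguments.\<close>

lemma power_sum_zero_on_imp_zero:
  fixes c :: "nat \<Rightarrow> 'a :: field"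
  assumes zero: "\<And>x. x \<in> A \<Longrightarrow> (\<Sum>r<n. c r * x ^ r) = 0"
    and A: "finite A" "n \<le> card A" and "r < n"
  shows "c r = 0"
proof -
  define p where "p = (\<Sum>r<n. Polynomial.monom (c r) r)"
  have coeff_p: "Polynomial.coeff p i = (if i < n then c i else 0)" for i
    by (simp add: p_def coeff_sum)
  have "p = 0"
  proof (rule ccontr)
    assume "p \<noteq> 0"
    have "n \<noteq> 0"
      using \<open>r < n\<close> by simp
    have "degree p \<le> n - 1"
      by (rule degree_le) (auto simp: coeff_p)
    moreover have "A \<subseteq> {x. poly p x = 0}"
      using zero by (auto simp: p_def poly_sum poly_monom)
    then have "card A \<le> card {x. poly p x = 0}"
      by (intro card_mono poly_roots_finite \<open>p \<noteq> 0\<close>)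
    moreover have "card {x. poly p x = 0} \<le> degree p"
      by (rule card_poly_roots_bound) fact
    ultimately show False
      using A \<open>n \<noteq> 0\<close> by linarith
  qed
  then show ?thesis
    using coeff_p[of r] \<open>r < n\<close> by simp
qed

text \<open>Domain and codomain of the linear map both have \<open>card UNIV ^ n\<close> elements,
  so injectivity already gives surjectivity. Counting replaces the inversion of a square matrix.
  Extensional functions keep both sets finite.\<close>

lemma trivial_kernel_imp_surj:
  fixes X :: "nat \<Rightarrow> 'b \<Rightarrow> 'a :: {field, finite}"
  assumes A: "finite A" "card A = n"
    and ker: "\<And>c. (\<And>j. j \<in> A \<Longrightarrow> (\<Sum>r<n. c r * X r j) = 0) \<Longrightarrow> (\<forall>r<n. c r = 0)"
  obtains c where "\<And>j. j \<in> A \<Longrightarrow> v j = (\<Sum>r<n. c r * X r j)"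
proof -
  let ?D = "{..<n} \<rightarrow>\<^sub>E (UNIV :: 'a set)" and ?R = "A \<rightarrow>\<^sub>E (UNIV :: 'a set)"
  define T where "T c = restrict (\<lambda>j. \<Sum>r<n. c r * X r j) A" for c
  have "inj_on T ?D"
  proof (rule inj_onI)
    fix c d
    assume cd: "c \<in> ?D" "d \<in> ?D" "T c = T d"
    have "(\<Sum>r<n. (c r - d r) * X r j) = 0" if "j \<in> A" for j
      using fun_cong[OF cd(3), of j] that by (simp add: T_def left_diff_distrib sum_subtractf)
    then have "\<forall>r<n. c r - d r = 0"
      by (rule ker)
    then show "c = d"
      using cd by (intro PiE_ext[of c "{..<n}" "\<lambda>_. UNIV" d]) auto
  qed
  then have "card (T ` ?D) = card ?R"
    using A by (simp add: card_image card_funcsetE)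
  moreover have "T ` ?D \<subseteq> ?R"
    by (intro image_subsetI) (simp add: T_def)
  moreover have "finite ?R"
    using A by (intro finite_PiE) auto
  ultimately have "T ` ?D = ?R"
    by (intro card_subset_eq)
  then have "restrict v A \<in> T ` ?D"
    by simp
  then obtain c where c: "restrict v A = T c"
    by blast
  have "v j = (\<Sum>r<n. c r * X r j)" if "j \<in> A" for j
    using that fun_cong[OF c, of j] by (simp add: T_def)
  then show ?thesis
    by (rule that)
qed

lemma over_prime_subfield_row_iff:
  assumes "A \<in> carrier_mat 1 n"
  shows "over_prime_subfield A \<longleftrightarrow> (\<forall>r<n. A $$ (0, r) \<in> prime_subfield)"
  using assms by (auto simp: over_prime_subfield_def elements_mat_def)

section \<open>Frobenius and the prime subfield\<close>

locale cyclic_field =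
  fixes q L :: nat and \<beta> :: "'a :: {field, finite}"
  assumes prime_q: "prime q" and L_gt_1: "1 < L" and coprime_q_L: "coprime q L"
    and card_field: "card (UNIV :: 'a set) = q ^ ord L q"
    and primitive: "primitive_root_of_unity L \<beta>"
begin

abbreviation "m \<equiv> ord L q"
abbreviation "N \<equiv> cop_card L"

text \<open>The characteristic is a prime dividing the cardinality \<open>q ^ m\<close>, and
  \<open>q\<close> is prime.\<close>

lemma CHAR_eq: "CHAR('a) = q"
proof -
  have "CHAR('a) > 0"
    by (rule finite_imp_CHAR_pos) simp
  then have "prime CHAR('a)"
    by (rule prime_CHAR_semidom)
  moreover have "CHAR('a) dvd q ^ m"
    using CHAR_dvd_CARD[where ?'a = 'a] card_field by simp
  ultimately show ?thesis
    using prime_q by (metis prime_dvd_power primes_dvd_imp_eq)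
qed

lemma frob_sum: "sum f A ^ q ^ i = (\<Sum>x\<in>A. f x ^ q ^ i)" for f :: "'b \<Rightarrow> 'a"
  by (rule freshmans_dream_sum'[where n = i]) (auto simp: CHAR_eq prime_q)

lemma frob_sum1: "sum f A ^ q = (\<Sum>x\<in>A. f x ^ q)" for f :: "'b \<Rightarrow> 'a"
  using frob_sum[of f A 1] by simp

lemma frob_add: "(x + y) ^ q = x ^ q + y ^ q" for x y :: 'a
  by (rule freshmans_dream) (simp_all add: CHAR_eq prime_q)

lemma frob_diff: "(x - y) ^ q = x ^ q - y ^ q" for x y :: 'a
  using frob_add[of "x - y" y] by simp

lemma power_card: "x ^ q ^ m = x" for x :: 'a
  using finite_field_power_card[of x] by (simp add: card_field)

lemma m_pos: "m > 0"
  using coprime_q_L by (simp add: coprime_commute)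

text \<open>The prime subfield is squeezed between two bounds: it lies among the roots of
  \<open>x ^ q - x\<close>, of which there are at most \<open>q\<close>, and the images of
  \<open>0, ..., q - 1\<close> are \<open>q\<close> distinct elements of it. Hence membership
  becomes the equation \<open>x ^ q = x\<close>.\<close>

lemma prime_subfield_props:
  shows prime_subfield_iff: "x \<in> prime_subfield \<longleftrightarrow> x ^ q = (x :: 'a)"
    and card_prime_subfield: "card (prime_subfield :: 'a set) = q"
proof -
  let ?R = "{x :: 'a. x ^ q = x}"
  \<comment> \<open>Fermat's little theorem, by induction from the additivity of Frobenius.\<close>
  have nat_fix: "of_nat i ^ q = (of_nat i :: 'a)" for i
  proof (induction i)
    case (Suc i)
    then show ?case
      using frob_add[of 1 "of_nat i"] by simp
  qed (use prime_gt_0_nat[OF prime_q] in \<open>simp add: power_0_left\<close>)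
  have q_zero: "of_nat q = (0 :: 'a)"
    using of_nat_CHAR[where ?'a = 'a] by (simp add: CHAR_eq)
  have "(prime_subfield :: 'a set) \<subseteq> ?R"
  proof
    fix x :: 'a
    assume "x \<in> prime_subfield"
    then obtain z :: int where z: "x = of_int z"
      by (auto simp: prime_subfield_def)
    have "x = of_int (z mod int q)"
      using of_int_eq_iff_cong_CHAR[where ?'a = 'a, of z "z mod int q"]
      by (simp add: z CHAR_eq cong_def)
    also have "\<dots> = of_int (int (nat (z mod int q)))"
      using prime_gt_0_nat[OF prime_q] by simp
    also have "\<dots> = of_nat (nat (z mod int q))"
      by (rule of_int_of_nat_eq)
    finally show "x \<in> ?R"
      using nat_fix by simp
  qed
  moreover have "card ?R \<le> q"
  proof -
    let ?p = "Polynomial.monom 1 q - Polynomial.monom 1 1 :: 'a poly"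
    have "Polynomial.coeff ?p q = 1"
      using prime_gt_1_nat[OF prime_q] by simp
    then have "?p \<noteq> 0"
      by (metis Polynomial.coeff_0 zero_neq_one)
    moreover have "degree ?p \<le> q"
      using prime_gt_1_nat[OF prime_q] by (intro degree_diff_le order.trans[OF degree_monom_le]) auto
    moreover have "?R = {x. poly ?p x = 0}"
      by (auto simp: poly_monom)
    ultimately show ?thesis
      using card_poly_roots_bound[of ?p] by simp
  qed
  moreover have "q \<le> card (prime_subfield :: 'a set)"
  proof -
    have "inj_on (of_nat :: nat \<Rightarrow> 'a) {..<q}"
      by (auto simp: inj_on_def of_nat_eq_iff_cong_CHAR CHAR_eq cong_def)
    then have "q = card ((of_nat :: nat \<Rightarrow> 'a) ` {..<q})"
      by (simp add: card_image)
    also have "\<dots> \<le> card (prime_subfield :: 'a set)"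
      unfolding prime_subfield_def by (intro card_mono) (auto simp: image_iff intro: of_int_of_nat_eq[symmetric])
    finally show ?thesis .
  qed
  ultimately have "(prime_subfield :: 'a set) = ?R" "card (prime_subfield :: 'a set) = q"
    using card_seteq[of ?R prime_subfield] card_mono[of ?R prime_subfield] by simp_all
  then show "x \<in> prime_subfield \<longleftrightarrow> x ^ q = (x :: 'a)" "card (prime_subfield :: 'a set) = q"
    by auto
qed

lemma frob_fixed_power: "x ^ q = x \<Longrightarrow> x ^ q ^ i = x" for x :: 'a
  by (induction i) (simp_all add: power_mult)

subsection \<open>Powers of the root of unity\<close>

lemma \<beta>_power_L: "\<beta> ^ L = 1"
  using primitive by (simp add: primitive_root_of_unity_def)

lemma \<beta>_nonzero: "\<beta> \<noteq> 0"
  using \<beta>_power_L L_gt_1 by (auto simp: power_0_left)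

lemma \<beta>_power_mod: "\<beta> ^ (i mod L) = \<beta> ^ i"
proof -
  have "\<beta> ^ i = \<beta> ^ (L * (i div L) + i mod L)"
    by simp
  also have "\<dots> = \<beta> ^ (i mod L)"
    unfolding power_add power_mult by (simp add: \<beta>_power_L)
  finally show ?thesis ..
qed

lemma \<beta>_power_eq_1_iff: "\<beta> ^ i = 1 \<longleftrightarrow> L dvd i"
proof
  assume "\<beta> ^ i = 1"
  then have "\<beta> ^ (i mod L) = 1"
    by (simp add: \<beta>_power_mod)
  moreover have "i mod L < L"
    using L_gt_1 by simp
  ultimately show "L dvd i"
    using primitive unfolding primitive_root_of_unity_def by (auto simp: dvd_eq_mod_eq_0)
qed (auto simp: power_mult \<beta>_power_L)

lemma \<beta>_power_eq_iff: "\<beta> ^ i = \<beta> ^ j \<longleftrightarrow> [i = j] (mod L)"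
proof (induction i j rule: linorder_wlog)
  case (le i j)
  then obtain d where d: "j = i + d"
    using le_Suc_ex by blast
  show ?case
    using \<beta>_nonzero \<beta>_power_eq_1_iff[of d]
    by (simp add: d power_add cong_add_lcancel_0_nat cong_0_iff eq_commute[of 1] cong_sym_eq[of i])
qed (simp add: eq_commute cong_sym_eq)

lemma \<beta>_power_inj: "i < L \<Longrightarrow> j < L \<Longrightarrow> \<beta> ^ i = \<beta> ^ j \<longleftrightarrow> i = j"
  by (simp add: \<beta>_power_eq_iff cong_def)

lemma \<beta>_cong: "[i = j] (mod L) \<Longrightarrow> \<beta> ^ i = \<beta> ^ j"
  by (simp add: \<beta>_power_eq_iff)

lemma L_nonzero: "of_nat L \<noteq> (0 :: 'a)"
  unfolding of_nat_eq_0_iff_char_dvd CHAR_eq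
  using coprime_q_L prime_q by (metis coprime_common_divisor dvd_refl not_prime_unit)

text \<open>A geometric sum with ratio \<open>w\<close> equal to \<beta> to the power
  \<open>a - b\<close>. Since \<open>w ^ L = 1\<close>, it vanishes unless \<open>w = 1\<close>, and
  for exponents below \<open>L\<close> that means \<open>a = b\<close>.\<close>

lemma orthogonality:
  assumes "a < L" "b < L"
  shows "(\<Sum>j<L. \<beta> ^ (a * j) * inverse (\<beta> ^ (b * j))) = (if a = b then of_nat L else 0)"
proof -
  define w where "w = \<beta> ^ a * inverse (\<beta> ^ b)"
  have sum_eq: "(\<Sum>j<L. \<beta> ^ (a * j) * inverse (\<beta> ^ (b * j))) = (\<Sum>j<L. w ^ j)"
    by (simp add: w_def power_mult_distrib power_mult power_inverse)
  have "w ^ L = 1"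
  proof -
    have "w ^ L = (\<beta> ^ L) ^ a * inverse ((\<beta> ^ L) ^ b)"
      by (simp add: w_def power_mult_distrib power_inverse mult.commute flip: power_mult)
    then show ?thesis
      by (simp add: \<beta>_power_L)
  qed
  moreover have "w = 1 \<longleftrightarrow> a = b"
    using \<beta>_power_inj[OF assms] \<beta>_nonzero by (auto simp: w_def field_simps)
  ultimately show ?thesis
    by (simp add: sum_eq sum_gp_strict)
qed

lemma cop_set_eq: "cop_set L = {j. j < L \<and> coprime j L}"
proof -
  have "1 \<le> j" if "coprime j L" for j
    using that L_gt_1 by (cases j) auto
  moreover have "j \<le> L - 1 \<longleftrightarrow> j < L" for j
    using L_gt_1 by auto
  ultimately show ?thesis
    unfolding cop_set_def coprime_iff_gcd_eq_1[symmetric] by blast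
qed

lemma cop_set_finite: "finite (cop_set L)"
  by (simp add: cop_set_eq)

lemma mult_q_mod_inj: "inj_on (\<lambda>j. j * q mod L) {..<L}"
  using coprime_q_L
  by (auto simp: inj_on_def cong_def[symmetric] cong_mult_rcancel_nat cong_less_modulus_unique_nat)

text \<open>This permutation of the units is the action of Frobenius on the exponents of
  \<beta>.\<close>

lemma mult_q_mod_bij: "bij_betw (\<lambda>j. j * q mod L) (cop_set L) (cop_set L)"
proof -
  have "inj_on (\<lambda>j. j * q mod L) (cop_set L)"
    by (rule inj_on_subset[OF mult_q_mod_inj]) (auto simp: cop_set_eq)
  moreover have "(\<lambda>j. j * q mod L) ` cop_set L \<subseteq> cop_set L"
    using L_gt_1 coprime_q_L by (auto simp: cop_set_eq)
  ultimately show ?thesis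
    by (simp add: bij_betw_def endo_inj_surj cop_set_finite)
qed

lemma mult_q_mod_bij_compl:
  "bij_betw (\<lambda>j. j * q mod L) ({0..<L} - cop_set L) ({0..<L} - cop_set L)"
proof -
  have "inj_on (\<lambda>j. j * q mod L) ({0..<L} - cop_set L)"
    by (rule inj_on_subset[OF mult_q_mod_inj]) auto
  moreover have "(\<lambda>j. j * q mod L) ` ({0..<L} - cop_set L) \<subseteq> {0..<L} - cop_set L"
    using L_gt_1 coprime_q_L by (auto simp: cop_set_eq)
  ultimately show ?thesis
    by (simp add: bij_betw_def endo_inj_surj)
qed

lemma mult_q_mod_power: "\<beta> ^ (a * (j * q mod L)) = (\<beta> ^ (a * j)) ^ q"
  unfolding power_mult[symmetric] by (rule \<beta>_cong) (simp add: cong_def mod_mult_right_eq mult.assoc)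

lemma card_cop_le: "N \<le> L"
  using card_mono[of "{..<L}" "cop_set L"] by (auto simp: cop_set_eq)

subsection \<open>Diagonalisation of the cyclic shift\<close>

lemma cyclic_mat_carrier: "cyclic_mat L \<in> carrier_mat L L"
  using L_gt_1 by (auto simp: cyclic_mat_def intro!: carrier_matI)

lemma cyclic_mat_index:
  assumes "i < L" "j < L"
  shows "cyclic_mat L $$ (i, j) = (if j = Suc i mod L then 1 else 0 :: 'a)"
proof -
  have "Suc i mod L = (if i = L - 1 then 0 else Suc i)"
    using assms by auto
  then show ?thesis
    using assms L_gt_1 unfolding cyclic_mat_def by (auto simp: one_mat_def)
qed

lemma cyclic_mat_power:
  "cyclic_mat L ^\<^sub>m e = mat L L (\<lambda>(i, j). if j = (i + e) mod L then 1 else 0 :: 'a)"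
proof (induction e)
  case 0
  show ?case
    using cyclic_mat_carrier by (intro eq_matI) (auto simp: one_mat_def)
next
  case (Suc e)
  have "(\<Sum>b<L. (if b = (i + e) mod L then 1 else 0) * cyclic_mat L $$ (b, j)) =
        (if j = Suc (i + e) mod L then 1 else 0 :: 'a)"
    if "i < L" "j < L" for i j
  proof -
    have "(\<Sum>b<L. (if b = (i + e) mod L then 1 else 0) * cyclic_mat L $$ (b, j)) =
      (\<Sum>b<L. if b = (i + e) mod L then cyclic_mat L $$ (b, j) else 0 :: 'a)"
      by (intro sum.cong) auto
    also have "\<dots> = cyclic_mat L $$ ((i + e) mod L, j)"
      using L_gt_1 by (subst sum.delta) auto
    also have "\<dots> = (if j = Suc (i + e) mod L then 1 else 0)"
      using that L_gt_1 by (subst cyclic_mat_index) (auto simp: mod_Suc_eq)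
    finally show ?thesis .
  qed
  then show ?case
    using cyclic_mat_carrier
    by (intro eq_matI) (auto simp: Suc scalar_prod_def lessThan_atLeast0)
qed

text \<open>Entrywise form of \<open>V_mat\<close> times \<open>diag f\<close> times
  \<open>V_tilde_mat\<close>, divided by \<open>L\<close>: the circulant matrix with eigenvalue
  \<open>f j\<close> on column \<open>j\<close> of \<open>V_mat\<close>.\<close>

definition spectral :: "(nat \<Rightarrow> 'a) \<Rightarrow> 'a mat" where
  "spectral f = mat L L (\<lambda>(a, b).
     inverse (of_nat L) * (\<Sum>j<L. \<beta> ^ (a * j) * f j * inverse (\<beta> ^ (b * j))))"

lemma spectral_carrier [simp]: "spectral f \<in> carrier_mat L L"
  by (simp add: spectral_def)

lemma spectral_dim [simp]: "dim_row (spectral f) = L" "dim_col (spectral f) = L"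
  by (simp_all add: spectral_def)

text \<open>The eigenvalue is absorbed into the row factor, which turns row \<open>a\<close> into
  row \<open>a + e\<close> modulo \<open>L\<close>. Orthogonality then leaves the single entry of
  the shifted identity.\<close>

lemma cyclic_mat_power_spectral: "cyclic_mat L ^\<^sub>m e = spectral (\<lambda>j. \<beta> ^ (e * j))"
proof (rule eq_matI)
  fix a b
  assume "a < dim_row (spectral (\<lambda>j. \<beta> ^ (e * j)))" "b < dim_col (spectral (\<lambda>j. \<beta> ^ (e * j)))"
  then have ab: "a < L" "b < L"
    by simp_all
  have "\<beta> ^ (a * j) * \<beta> ^ (e * j) = \<beta> ^ ((a + e) mod L * j)" for j
    unfolding power_add[symmetric] by (rule \<beta>_cong) (simp add: cong_def mod_mult_left_eq add_mult_distrib)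
  then have "spectral (\<lambda>j. \<beta> ^ (e * j)) $$ (a, b) =
      inverse (of_nat L) * (\<Sum>j<L. \<beta> ^ ((a + e) mod L * j) * inverse (\<beta> ^ (b * j)))"
    using ab by (simp add: spectral_def)
  also have "\<dots> = (if (a + e) mod L = b then 1 else 0)"
    using ab L_gt_1 L_nonzero by (subst orthogonality) auto
  finally show "(cyclic_mat L ^\<^sub>m e) $$ (a, b) = spectral (\<lambda>j. \<beta> ^ (e * j)) $$ (a, b)"
    using ab by (simp add: cyclic_mat_power)
qed (simp_all add: cyclic_mat_power)

lemma poly_mat_spectral: "poly_mat p (cyclic_mat L) = spectral (\<lambda>j. poly p (\<beta> ^ j))"
proof -
  have "(\<Sum>i\<le>degree p. Polynomial.coeff p i *
          (inverse (of_nat L) * (\<Sum>j<L. \<beta> ^ (a * j) * \<beta> ^ (i * j) * inverse (\<beta> ^ (b * j))))) =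
        inverse (of_nat L) * (\<Sum>j<L. \<beta> ^ (a * j) * poly p (\<beta> ^ j) * inverse (\<beta> ^ (b * j)))" for a b
    unfolding poly_altdef sum_distrib_left sum_distrib_right
    by (subst sum.swap) (auto intro!: sum.cong simp: power_mult mult_ac simp flip: power_mult)
  then show ?thesis
    using cyclic_mat_carrier
    by (intro eq_matI) (auto simp: poly_mat_def msum_def cyclic_mat_power_spectral, simp add: spectral_def)
qed

text \<open>After the sum over the middle index \<open>c\<close> is moved innermost, orthogonality
  forces the two spectral indices to agree and supplies the factor \<open>L\<close> that cancels one
  of the two normalisations.\<close>

lemma spectral_mult: "spectral f * spectral g = spectral (\<lambda>j. f j * g j)"
proof (rule eq_matI)
  fix a b
  assume "a < dim_row (spectral (\<lambda>j. f j * g j))" "b < dim_col (spectral (\<lambda>j. f j * g j))"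
  then have ab: "a < L" "b < L"
    by simp_all
  let ?i = "inverse (of_nat L :: 'a)"
  have prod_of_sums: "(?i * sum u A) * (?i * sum v B) = (\<Sum>x\<in>A. \<Sum>y\<in>B. ?i * ?i * (u x * v y))"
    for u v and A B :: "nat set"
    by (simp add: mult_ac flip: sum_distrib_left sum_distrib_right)
  have "(spectral f * spectral g) $$ (a, b) =
    (\<Sum>c<L. (?i * (\<Sum>j<L. \<beta> ^ (a * j) * f j * inverse (\<beta> ^ (c * j)))) *
            (?i * (\<Sum>j'<L. \<beta> ^ (c * j') * g j' * inverse (\<beta> ^ (b * j')))))"
    using ab by (simp add: scalar_prod_def lessThan_atLeast0 spectral_def)
  also have "\<dots> = (\<Sum>c<L. \<Sum>j<L. \<Sum>j'<L. ?i * ?i * \<beta> ^ (a * j) * f j * g j' * inverse (\<beta> ^ (b * j')) *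
      (\<beta> ^ (j' * c) * inverse (\<beta> ^ (j * c))))"
    unfolding prod_of_sums by (simp add: mult_ac)
  also have "\<dots> = (\<Sum>j<L. \<Sum>c<L. \<Sum>j'<L. ?i * ?i * \<beta> ^ (a * j) * f j * g j' * inverse (\<beta> ^ (b * j')) *
      (\<beta> ^ (j' * c) * inverse (\<beta> ^ (j * c))))"
    by (rule sum.swap)
  also have "\<dots> = (\<Sum>j<L. \<Sum>j'<L. \<Sum>c<L. ?i * ?i * \<beta> ^ (a * j) * f j * g j' * inverse (\<beta> ^ (b * j')) *
      (\<beta> ^ (j' * c) * inverse (\<beta> ^ (j * c))))"
    by (intro sum.cong sum.swap refl)
  also have "\<dots> = (\<Sum>j<L. \<Sum>j'<L. ?i * ?i * \<beta> ^ (a * j) * f j * g j' * inverse (\<beta> ^ (b * j')) *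
      (if j' = j then of_nat L else 0))"
    by (intro sum.cong refl) (simp add: orthogonality flip: sum_distrib_left)
  also have "\<dots> = (\<Sum>j<L. ?i * ?i * \<beta> ^ (a * j) * f j * g j * inverse (\<beta> ^ (b * j)) * of_nat L)"
    by (intro sum.cong refl) (simp add: if_distrib sum.delta cong: if_cong)
  also have "\<dots> = spectral (\<lambda>j. f j * g j) $$ (a, b)"
    using ab L_nonzero
    by (simp add: spectral_def sum_distrib_left) (intro sum.cong refl, simp add: field_simps \<beta>_nonzero)
  finally show "(spectral f * spectral g) $$ (a, b) = spectral (\<lambda>j. f j * g j) $$ (a, b)" .
qed simp_all

text \<open>The result is \<open>diag f\<close> times \<open>V_tilde_mat\<close>: its rows are left
  eigenvectors of every circulant matrix.\<close>

lemma V_tilde_spectral: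
  "V_tilde_mat L \<beta> * spectral f = mat L L (\<lambda>(j, b). f j * inverse (\<beta> ^ (b * j)))"
proof (rule eq_matI)
  fix j b
  assume "j < dim_row (mat L L (\<lambda>(j, b). f j * inverse (\<beta> ^ (b * j))))"
    "b < dim_col (mat L L (\<lambda>(j, b). f j * inverse (\<beta> ^ (b * j))))"
  then have jb: "j < L" "b < L"
    by simp_all
  let ?i = "inverse (of_nat L :: 'a)"
  have "(V_tilde_mat L \<beta> * spectral f) $$ (j, b) =
    (\<Sum>c<L. inverse (\<beta> ^ (j * c)) * (?i * (\<Sum>j'<L. \<beta> ^ (c * j') * f j' * inverse (\<beta> ^ (b * j')))))"
    using jb by (simp add: scalar_prod_def lessThan_atLeast0 spectral_def V_tilde_mat_def)
  also have "\<dots> = (\<Sum>c<L. \<Sum>j'<L. ?i * f j' * inverse (\<beta> ^ (b * j')) *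
      (\<beta> ^ (j' * c) * inverse (\<beta> ^ (j * c))))"
    by (simp add: sum_distrib_left mult_ac)
  also have "\<dots> = (\<Sum>j'<L. \<Sum>c<L. ?i * f j' * inverse (\<beta> ^ (b * j')) *
      (\<beta> ^ (j' * c) * inverse (\<beta> ^ (j * c))))"
    by (rule sum.swap)
  also have "\<dots> = (\<Sum>j'<L. ?i * f j' * inverse (\<beta> ^ (b * j')) * (if j' = j then of_nat L else 0))"
    using jb by (intro sum.cong refl) (simp add: orthogonality flip: sum_distrib_left)
  also have "\<dots> = f j * inverse (\<beta> ^ (b * j))"
    using jb L_nonzero by (simp add: if_distrib sum.delta cong: if_cong)
  finally show "(V_tilde_mat L \<beta> * spectral f) $$ (j, b) =
      mat L L (\<lambda>(j, b). f j * inverse (\<beta> ^ (b * j))) $$ (j, b)"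
    using jb by simp
qed (simp_all add: V_tilde_mat_def)

lemma V_tilde_V: "V_tilde_mat L \<beta> * V_mat L \<beta> = of_nat L \<cdot>\<^sub>m 1\<^sub>m L"
proof (rule eq_matI)
  fix i j
  assume "i < dim_row (of_nat L \<cdot>\<^sub>m 1\<^sub>m L :: 'a mat)" "j < dim_col (of_nat L \<cdot>\<^sub>m 1\<^sub>m L :: 'a mat)"
  then have ij: "i < L" "j < L"
    by simp_all
  then have "(V_tilde_mat L \<beta> * V_mat L \<beta>) $$ (i, j) =
      (\<Sum>c<L. \<beta> ^ (j * c) * inverse (\<beta> ^ (i * c)))"
    by (simp add: scalar_prod_def lessThan_atLeast0 V_tilde_mat_def V_mat_def mult_ac)
  then show "(V_tilde_mat L \<beta> * V_mat L \<beta>) $$ (i, j) = (of_nat L \<cdot>\<^sub>m 1\<^sub>m L) $$ (i, j)"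
    using ij orthogonality[of j i] by simp
qed (simp_all add: V_tilde_mat_def V_mat_def)

lemma leading_id_carrier [simp]: "leading_id nr nc \<in> carrier_mat nr nc"
  by (simp add: leading_id_def)

lemma mult_leading_id_transpose:
  fixes A :: "'b :: field mat"
  assumes "A \<in> carrier_mat nr nc" "c < n" "r < nr" "n \<le> nc"
  shows "(A * (leading_id n nc)\<^sup>T) $$ (r, c) = A $$ (r, c)"
  using assms
  by (simp add: leading_id_def scalar_prod_def if_distrib sum.delta cong: if_cong)

lemma leading_id_mult:
  fixes A :: "'b :: field mat"
  assumes "A \<in> carrier_mat nc m'" "r < n" "c < m'" "n \<le> nc"
  shows "(leading_id n nc * A) $$ (r, c) = A $$ (r, c)"
proof -
  have "(leading_id n nc * A) $$ (r, c) = (\<Sum>i\<in>{0..<nc}. (if r = i then 1 else 0) * A $$ (i, c))"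
    using assms by (simp add: leading_id_def scalar_prod_def)
  also have "\<dots> = (\<Sum>i\<in>{0..<nc}. if r = i then A $$ (i, c) else 0)"
    by (intro sum.cong) auto
  also have "\<dots> = A $$ (r, c)"
    using assms by simp
  finally show ?thesis .
qed

subsection \<open>Spectral form of the circular-shift-based codes\<close>

lemma cop_set_zero: "0 \<notin> cop_set L"
  by (simp add: cop_set_def)

text \<open>Multiplying \<open>H\<close> by \<open>V_tilde_mat\<close> recovers \<open>L\<close>
  times the transpose of \<open>U'\<close>, so the choice of \<open>H\<close> determines
  \<open>U'\<close> completely. Hence the inverse \<open>W\<close> of the selected columns of
  \<open>U\<close> is the explicit matrix of entries \<open>inverse (\<beta> ^ (r * j))\<close>. The
  first two conclusions are the two sides of this inverse relation, and the third is the
  diagonalised product.\<close>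

lemma admissible_pair_H_leading_id:
  assumes adm: "admissible_pair L \<beta> G H" and H: "H = (leading_id N L)\<^sup>T"
  obtains U where
    "\<And>r c. r < N \<Longrightarrow> c < N \<Longrightarrow>
       (\<Sum>j\<in>cop_set L. U r j * inverse (\<beta> ^ (c * j))) = (if r = c then 1 else 0)"
    and "\<And>i j. i \<in> cop_set L \<Longrightarrow> j \<in> cop_set L \<Longrightarrow>
       (\<Sum>r<N. inverse (\<beta> ^ (r * i)) * U r j) = (if i = j then 1 else 0)"
    and "\<And>e r c. r < N \<Longrightarrow> c < N \<Longrightarrow>
       (G * (cyclic_mat L ^\<^sub>m e) * H) $$ (r, c) =
       (\<Sum>j\<in>cop_set L. U r j * \<beta> ^ (e * j) * inverse (\<beta> ^ (c * j)))"
    and "G \<in> carrier_mat N L"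
proof -
  from adm obtain U U' W where U: "U \<in> carrier_mat N L" and U': "U' \<in> carrier_mat N L"
    and W: "W \<in> carrier_mat N N"
    and inv: "inverts_mat (select_cols U (cop_set L)) W" "inverts_mat W (select_cols U (cop_set L))"
    and U'W: "(select_cols U' (cop_set L))\<^sup>T = inverse (of_nat L) \<cdot>\<^sub>m W"
    and vanish: "(\<forall>j<L. j \<notin> cop_set L \<longrightarrow> col U j = 0\<^sub>v N) \<or>
        (\<forall>j<L. j \<notin> cop_set L \<longrightarrow> col U' j = 0\<^sub>v N)"
    and G: "G = U * V_tilde_mat L \<beta>" and HU': "H = V_mat L \<beta> * U'\<^sup>T"
    unfolding admissible_pair_def by blast
  \<comment> \<open>Selected columns are numbered by position, spectral sums by residue;
    \<open>cs\<close> translates between the two.\<close>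
  define cs where "cs = sorted_list_of_set (cop_set L)"
  have cs: "set cs = cop_set L" "distinct cs" "length cs = N"
    using cop_set_finite by (simp_all add: cs_def)
  then have cs_bij: "bij_betw ((!) cs) {..<N} (cop_set L)"
    by (intro bij_betw_nth) auto
  have cs_less: "cs ! a < L" "cs ! a \<in> cop_set L" if "a < N" for a
    using that cs nth_mem[of a cs] by (auto simp: cop_set_eq)
  have select: "select_cols X (cop_set L) $$ (r, a) = X $$ (r, cs ! a)"
    if "X \<in> carrier_mat N L" "r < N" "a < N" for X :: "'a mat" and r a
    using that cs cs_less[of a] by (auto simp: select_cols_def mat_of_cols_index simp flip: cs_def)
  have select_carrier: "select_cols X (cop_set L) \<in> carrier_mat N N"
    if "X \<in> carrier_mat N L" for X :: "'a mat"
    using that cs by (auto simp: select_cols_def simp flip: cs_def)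
  have "V_tilde_mat L \<beta> * H = (V_tilde_mat L \<beta> * V_mat L \<beta>) * U'\<^sup>T"
    unfolding HU' using U'
    by (subst assoc_mult_mat[of _ L L _ L _ N]) (auto simp: V_tilde_mat_def V_mat_def)
  also have "\<dots> = of_nat L \<cdot>\<^sub>m U'\<^sup>T"
    unfolding V_tilde_V using U' by (subst mult_smult_assoc_mat[of _ L L _ N]) auto
  finally have VH: "V_tilde_mat L \<beta> * H = of_nat L \<cdot>\<^sub>m U'\<^sup>T" .
  have U'_entry: "of_nat L * U' $$ (r, j) = inverse (\<beta> ^ (r * j))" if "r < N" "j < L" for r j
  proof -
    have "(V_tilde_mat L \<beta> * H) $$ (j, r) = V_tilde_mat L \<beta> $$ (j, r)"
      unfolding H using that card_cop_le
      by (intro mult_leading_id_transpose[where nc = L and nr = L]) (auto simp: V_tilde_mat_def)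
    then show ?thesis
      unfolding VH using that U' card_cop_le by (simp add: V_tilde_mat_def mult.commute)
  qed
  have W_entry: "W $$ (a, r) = inverse (\<beta> ^ (r * cs ! a))" if "a < N" "r < N" for a r
  proof -
    have "(select_cols U' (cop_set L))\<^sup>T $$ (a, r) = U' $$ (r, cs ! a)"
      using that select[OF U'] select_carrier[OF U'] by simp
    then have "U' $$ (r, cs ! a) = inverse (of_nat L) * W $$ (a, r)"
      unfolding U'W using that W by simp
    then show ?thesis
      using U'_entry[of r "cs ! a"] that cs_less L_nonzero by (simp flip: mult.assoc)
  qed
  have UW: "(\<Sum>j\<in>cop_set L. U $$ (r, j) * inverse (\<beta> ^ (c * j))) = (if r = c then 1 else 0)"
    if "r < N" "c < N" for r c
  proof -
    have "(select_cols U (cop_set L) * W) $$ (r, c) = (if r = c then 1 else 0)"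
      using inv(1) that select_carrier[OF U] unfolding inverts_mat_def by simp
    moreover have "(select_cols U (cop_set L) * W) $$ (r, c) =
        (\<Sum>a<N. U $$ (r, cs ! a) * inverse (\<beta> ^ (c * cs ! a)))"
      using that W select_carrier[OF U]
      by (simp add: scalar_prod_def select[OF U] W_entry lessThan_atLeast0)
    ultimately show ?thesis
      using sum.reindex_bij_betw[OF cs_bij, of "\<lambda>j. U $$ (r, j) * inverse (\<beta> ^ (c * j))"] by simp
  qed
  have WU: "(\<Sum>r<N. inverse (\<beta> ^ (r * i)) * U $$ (r, j)) = (if i = j then 1 else 0)"
    if "i \<in> cop_set L" "j \<in> cop_set L" for i j
  proof -
    have "i \<in> (!) cs ` {..<N}" "j \<in> (!) cs ` {..<N}"
      using that by (simp_all add: bij_betw_imp_surj_on[OF cs_bij])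
    then obtain a b where ab: "a < N" "b < N" "i = cs ! a" "j = cs ! b"
      by blast
    have "(W * select_cols U (cop_set L)) $$ (a, b) = (if a = b then 1 else 0)"
      using inv(2) ab W unfolding inverts_mat_def by simp
    moreover have "(W * select_cols U (cop_set L)) $$ (a, b) =
        (\<Sum>r<N. inverse (\<beta> ^ (r * i)) * U $$ (r, j))"
      using ab W select_carrier[OF U]
      by (simp add: scalar_prod_def select[OF U] W_entry lessThan_atLeast0)
    moreover have "a = b \<longleftrightarrow> i = j"
      using ab cs by (simp add: nth_eq_iff_index_eq)
    ultimately show ?thesis
      by simp
  qed
  \<comment> \<open>\<open>H = [I 0]\<^sup>T\<close> makes every entry of \<open>U'\<close> nonzero, and \<open>0\<close> is not coprime to \<open>L\<close>; so of the
    two alternatives in \<open>vanish\<close> only the one for \<open>U\<close> is possible.\<close>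
  have U_zero: "U $$ (r, j) = 0" if "j < L" "j \<notin> cop_set L" "r < N" for r j
  proof -
    have "\<not> (\<forall>j<L. j \<notin> cop_set L \<longrightarrow> col U' j = 0\<^sub>v N)"
    proof
      assume *: "\<forall>j<L. j \<notin> cop_set L \<longrightarrow> col U' j = 0\<^sub>v N"
      have "col U' 0 $ r = 0"
        using * cop_set_zero L_gt_1 that by simp
      then show False
        using U'_entry[of r 0] that L_gt_1 U' by simp
    qed
    then have "col U j = 0\<^sub>v N"
      using vanish that by blast
    then have "col U j $ r = 0"
      using that by simp
    then show ?thesis
      using that U by simp
  qed
  have entry: "(G * (cyclic_mat L ^\<^sub>m e) * H) $$ (r, c) =
       (\<Sum>j\<in>cop_set L. U $$ (r, j) * \<beta> ^ (e * j) * inverse (\<beta> ^ (c * j)))"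
    if "r < N" "c < N" for e r c
  proof -
    have "G * (cyclic_mat L ^\<^sub>m e) =
        U * mat L L (\<lambda>(j, b). \<beta> ^ (e * j) * inverse (\<beta> ^ (b * j)))" (is "_ = U * ?M")
      unfolding G cyclic_mat_power_spectral V_tilde_spectral[symmetric]
      using U by (intro assoc_mult_mat) (auto simp: V_tilde_mat_def)
    then have "(G * (cyclic_mat L ^\<^sub>m e) * H) $$ (r, c) = (U * ?M) $$ (r, c)"
      unfolding H using U that card_cop_le
      by (simp only:, intro mult_leading_id_transpose[where nc = L and nr = N]) auto
    also have "\<dots> = (\<Sum>j<L. U $$ (r, j) * \<beta> ^ (e * j) * inverse (\<beta> ^ (c * j)))"
      using U that card_cop_le by (simp add: scalar_prod_def lessThan_atLeast0 mult.assoc)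
    also have "\<dots> = (\<Sum>j\<in>cop_set L. U $$ (r, j) * \<beta> ^ (e * j) * inverse (\<beta> ^ (c * j)))"
      using U_zero that by (intro sum.mono_neutral_right) (auto simp: cop_set_eq)
    finally show ?thesis .
  qed
  have "G \<in> carrier_mat N L"
    unfolding G using U by (auto simp: V_tilde_mat_def)
  with UW WU entry show ?thesis
    by (rule that)
qed

section \<open>Values of \<open>tau\<close> at the powers of the root of unity\<close>

lemma tau_nonzero: "poly (tau L \<beta>) (\<beta> ^ j) \<noteq> 0" if "j \<in> cop_set L"
  using that by (auto simp: tau_def poly_prod \<beta>_power_inj cop_set_eq)

lemma tau_zero: "poly (tau L \<beta>) (\<beta> ^ j) = 0" if "j < L" "j \<notin> cop_set L"
  using that by (auto simp: tau_def poly_prod)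

text \<open>Frobenius permutes the roots of \<open>tau\<close>, since multiplication by
  \<open>q\<close> permutes the non-units. This serves in place of a proof that the coefficients lie
  in the prime subfield.\<close>

lemma tau_frob: "poly (tau L \<beta>) (\<beta> ^ (j * q mod L)) = poly (tau L \<beta>) (\<beta> ^ j) ^ q"
proof -
  have eq: "poly (tau L \<beta>) x = (\<Prod>i\<in>{0..<L} - cop_set L. x - \<beta> ^ i)" for x
    by (simp add: tau_def poly_prod)
  have "poly (tau L \<beta>) (\<beta> ^ j) ^ q = (\<Prod>i\<in>{0..<L} - cop_set L. \<beta> ^ (j * q mod L) - \<beta> ^ (i * q mod L))"
    using mult_q_mod_power[of 1] by (simp add: eq frob_diff prod_power_distrib)
  also have "\<dots> = poly (tau L \<beta>) (\<beta> ^ (j * q mod L))"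
    unfolding eq by (rule prod.reindex_bij_betw[OF mult_q_mod_bij_compl])
  finally show ?thesis ..
qed

text \<open>The shift power and \<open>tau\<close> of the shift are both circulant, so their product
  is diagonalised at once. The outer factors only cut out the leading \<open>N\<close> by
  \<open>N\<close> block, and the zeros of \<open>tau\<close> remove the non-unit indices.\<close>

lemma tau_code_entry:
  assumes "r < N" "c < N"
  shows "(leading_id N L * (cyclic_mat L ^\<^sub>m e) *
      (poly_mat (tau L \<beta>) (cyclic_mat L) * (leading_id N L)\<^sup>T)) $$ (r, c) =
    (\<Sum>j\<in>cop_set L. inverse (of_nat L) * \<beta> ^ (r * j) * poly (tau L \<beta>) (\<beta> ^ j) *
       \<beta> ^ (e * j) * inverse (\<beta> ^ (c * j)))"
proof -
  let ?t = "\<lambda>j. poly (tau L \<beta>) (\<beta> ^ j)"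
  let ?S = "spectral (\<lambda>j. \<beta> ^ (e * j) * ?t j)"
  have "leading_id N L * spectral (\<lambda>j. \<beta> ^ (e * j)) * (spectral ?t * (leading_id N L)\<^sup>T) =
    leading_id N L * (spectral (\<lambda>j. \<beta> ^ (e * j)) * (spectral ?t * (leading_id N L)\<^sup>T))"
    by (intro assoc_mult_mat[of _ N L _ L _ N] mult_carrier_mat[of _ L L]) auto
  also have "spectral (\<lambda>j. \<beta> ^ (e * j)) * (spectral ?t * (leading_id N L)\<^sup>T) = ?S * (leading_id N L)\<^sup>T"
    unfolding spectral_mult[symmetric] by (intro assoc_mult_mat[symmetric, of _ L L _ L _ N]) auto
  finally have "(leading_id N L * spectral (\<lambda>j. \<beta> ^ (e * j)) * (spectral ?t * (leading_id N L)\<^sup>T)) $$ (r, c) =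
      (leading_id N L * (?S * (leading_id N L)\<^sup>T)) $$ (r, c)"
    by (rule arg_cong)
  also have "\<dots> = (?S * (leading_id N L)\<^sup>T) $$ (r, c)"
    using assms card_cop_le by (intro leading_id_mult[where m' = N]) (auto intro!: mult_carrier_mat[of _ L L])
  also have "\<dots> = ?S $$ (r, c)"
    using assms card_cop_le by (intro mult_leading_id_transpose[where nr = L]) auto
  also have "\<dots> = (\<Sum>j<L. inverse (of_nat L) * \<beta> ^ (r * j) * ?t j * \<beta> ^ (e * j) * inverse (\<beta> ^ (c * j)))"
    using assms card_cop_le by (simp add: spectral_def sum_distrib_left mult_ac)
  also have "\<dots> = (\<Sum>j\<in>cop_set L. inverse (of_nat L) * \<beta> ^ (r * j) * ?t j * \<beta> ^ (e * j) * inverse (\<beta> ^ (c * j)))"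
    using tau_zero by (intro sum.mono_neutral_right) (auto simp: cop_set_eq)
  finally show ?thesis
    by (simp only: poly_mat_spectral cyclic_mat_power_spectral)
qed

section \<open>Frobenius-compatible spectra\<close>

text \<open>The conjugacy constraint known from discrete Fourier transforms of vectors over a
  subfield.\<close>

definition frob_compat :: "(nat \<Rightarrow> 'a) \<Rightarrow> bool" where
  "frob_compat v \<longleftrightarrow> (\<forall>j\<in>cop_set L. v (j * q mod L) = v j ^ q)"

definition spectral_code :: "nat \<Rightarrow> nat \<Rightarrow> (nat \<Rightarrow> nat) \<Rightarrow> 'a mat set" where
  "spectral_code k n l =
    {mat N n (\<lambda>(r, i). \<Sum>s<k. \<Sum>j\<in>cop_set L.
       v s j * \<beta> ^ (q ^ s * l i * j) * inverse (\<beta> ^ (r * j)))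
     | v. \<forall>s<k. frob_compat (v s)}"

lemma spectral_codeI:
  fixes v :: "nat \<Rightarrow> nat \<Rightarrow> 'a"
  assumes "\<And>s. s < k \<Longrightarrow> frob_compat (v s)" and "M \<in> carrier_mat N n"
    and "\<And>r i. r < N \<Longrightarrow> i < n \<Longrightarrow> M $$ (r, i) = (\<Sum>s<k. \<Sum>j\<in>cop_set L.
       v s j * \<beta> ^ (q ^ s * l i * j) * inverse (\<beta> ^ (r * j)))"
  shows "M \<in> spectral_code k n l"
  using assms unfolding spectral_code_def by (intro CollectI exI[of _ v]) (auto intro!: eq_matI)

text \<open>Counting gives coefficients over the large field. Raising the expansion to the power
  \<open>q\<close> yields an expansion of the same spectrum with coefficients
  \<open>c r ^ q\<close>, so the trivial kernel forces \<open>c r ^ q = c r\<close>.\<close>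

lemma frob_compat_expansion:
  assumes X: "\<And>r j. r < N \<Longrightarrow> j \<in> cop_set L \<Longrightarrow> X r (j * q mod L) = X r j ^ q"
    and ker: "\<And>c. (\<And>j. j \<in> cop_set L \<Longrightarrow> (\<Sum>r<N. c r * X r j) = 0) \<Longrightarrow> (\<forall>r<N. c r = 0)"
    and v: "frob_compat v"
  obtains c where "\<And>r. r < N \<Longrightarrow> c r \<in> prime_subfield"
    and "\<And>j. j \<in> cop_set L \<Longrightarrow> v j = (\<Sum>r<N. c r * X r j)"
proof -
  obtain c where c: "\<And>j. j \<in> cop_set L \<Longrightarrow> v j = (\<Sum>r<N. c r * X r j)"
    using trivial_kernel_imp_surj[OF cop_set_finite refl ker, where v = v] by blast
  have "(\<Sum>r<N. (c r ^ q - c r) * X r j) = 0" if j: "j \<in> cop_set L" for j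
  proof -
    \<comment> \<open>The preimage of \<open>j\<close> under multiplication by \<open>q\<close>, so
      that the values at \<open>j\<close> are the \<open>q\<close>-th powers of those at
      \<open>i\<close>.\<close>
    obtain i where i: "i \<in> cop_set L" "j = i * q mod L"
      using j mult_q_mod_bij unfolding bij_betw_def by blast
    have "(\<Sum>r<N. c r ^ q * X r j) = v i ^ q"
      using i X by (simp add: c frob_sum1 power_mult_distrib)
    also have "\<dots> = (\<Sum>r<N. c r * X r j)"
      using i j v c[OF j] by (simp add: frob_compat_def)
    finally show ?thesis
      by (simp add: left_diff_distrib sum_subtractf)
  qed
  then have "\<forall>r<N. c r ^ q - c r = 0"
    by (rule ker)
  then have "c r \<in> prime_subfield" if "r < N" for r
    using that by (simp add: prime_subfield_iff)
  with c show ?thesis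
    using that by blast
qed

text \<open>Here \<open>X\<close> is the change of coordinates from messages to spectra. Its
  compatibility with Frobenius sends messages over the prime subfield to compatible spectra; the
  trivial kernel gives the converse through \<open>frob_compat_expansion\<close>. Leaving
  \<open>X\<close> abstract covers both choices of \<open>P\<close> and \<open>Q\<close>.\<close>

lemma circ_shift_code_eq_spectral_code:
  assumes P: "P \<in> carrier_mat N L" and Q: "Q \<in> carrier_mat L N"
    and entry: "\<And>e r c. r < N \<Longrightarrow> c < N \<Longrightarrow> (P * (cyclic_mat L ^\<^sub>m e) * Q) $$ (r, c) =
       (\<Sum>j\<in>cop_set L. X r j * \<beta> ^ (e * j) * inverse (\<beta> ^ (c * j)))"
    and X: "\<And>r j. r < N \<Longrightarrow> j \<in> cop_set L \<Longrightarrow> X r (j * q mod L) = X r j ^ q"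
    and ker: "\<And>c. (\<And>j. j \<in> cop_set L \<Longrightarrow> (\<Sum>r<N. c r * X r j) = 0) \<Longrightarrow> (\<forall>r<N. c r = 0)"
  shows "circ_shift_code q L k n l P Q = spectral_code k n l"
proof -
  have row_entry: "(A * P * (cyclic_mat L ^\<^sub>m e) * Q) $$ (0, c) =
      (\<Sum>j\<in>cop_set L. (\<Sum>r<N. A $$ (0, r) * X r j) * \<beta> ^ (e * j) * inverse (\<beta> ^ (c * j)))"
    if "A \<in> carrier_mat 1 N" "c < N" for A e c
  proof -
    have C: "cyclic_mat L ^\<^sub>m e \<in> carrier_mat L L"
      by (rule pow_carrier_mat[OF cyclic_mat_carrier])
    have "A * P * (cyclic_mat L ^\<^sub>m e) * Q = A * (P * (cyclic_mat L ^\<^sub>m e)) * Q"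
      using that P C by (subst assoc_mult_mat[of A 1 N P L _ L]) auto
    also have "\<dots> = A * (P * (cyclic_mat L ^\<^sub>m e) * Q)"
      using that P Q C by (intro assoc_mult_mat[of A 1 N _ L _ N] mult_carrier_mat[of _ N L]) auto
    finally have "A * P * (cyclic_mat L ^\<^sub>m e) * Q = A * (P * (cyclic_mat L ^\<^sub>m e) * Q)" .
    moreover have "(A * (P * (cyclic_mat L ^\<^sub>m e) * Q)) $$ (0, c) =
        (\<Sum>r<N. A $$ (0, r) * (P * (cyclic_mat L ^\<^sub>m e) * Q) $$ (r, c))"
      using that P Q C by (subst index_mult_mat) (auto simp: scalar_prod_def lessThan_atLeast0 simp del: index_mult_mat(1))
    moreover have "\<dots> = (\<Sum>r<N. \<Sum>j\<in>cop_set L. A $$ (0, r) * (X r j * \<beta> ^ (e * j) * inverse (\<beta> ^ (c * j))))"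
      using that by (simp add: entry sum_distrib_left)
    moreover have "\<dots> = (\<Sum>j\<in>cop_set L. \<Sum>r<N. A $$ (0, r) * (X r j * \<beta> ^ (e * j) * inverse (\<beta> ^ (c * j))))"
      by (rule sum.swap)
    ultimately show ?thesis
      by (simp add: sum_distrib_right mult.assoc)
  qed
  have code_entry: "msum 1 N (\<lambda>s. A s * P * (cyclic_mat L ^\<^sub>m (q ^ s * l i)) * Q) {..<k} $$ (0, r) =
      (\<Sum>s<k. \<Sum>j\<in>cop_set L. (\<Sum>t<N. A s $$ (0, t) * X t j) *
         \<beta> ^ (q ^ s * l i * j) * inverse (\<beta> ^ (r * j)))"
    if "\<And>s. s < k \<Longrightarrow> A s \<in> carrier_mat 1 N" "r < N" for A r i
    using that by (simp add: msum_def row_entry)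
  show ?thesis
  proof (intro equalityI subsetI)
    fix M
    assume "M \<in> circ_shift_code q L k n l P Q"
    then obtain A where A: "\<And>s. s < k \<Longrightarrow> A s \<in> carrier_mat 1 N \<and> over_prime_subfield (A s)"
      and M: "M = mat N n (\<lambda>(r, i). msum 1 N (\<lambda>s. A s * P * (cyclic_mat L ^\<^sub>m (q ^ s * l i)) * Q) {..<k} $$ (0, r))"
      unfolding circ_shift_code_def by blast
    show "M \<in> spectral_code k n l"
    proof (rule spectral_codeI)
      fix s
      assume "s < k"
      then have "A s $$ (0, t) ^ q = A s $$ (0, t)" if "t < N" for t
        using A[of s] over_prime_subfield_row_iff[of "A s" N] that by (simp add: prime_subfield_iff)
      then show "frob_compat (\<lambda>j. \<Sum>t<N. A s $$ (0, t) * X t j)"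
        using X by (simp add: frob_compat_def frob_sum1 power_mult_distrib)
    next
      fix r i
      assume "r < N" "i < n"
      then show "M $$ (r, i) = (\<Sum>s<k. \<Sum>j\<in>cop_set L. (\<Sum>t<N. A s $$ (0, t) * X t j) *
         \<beta> ^ (q ^ s * l i * j) * inverse (\<beta> ^ (r * j)))"
        using code_entry[of A r i] A by (simp add: M)
    qed (simp add: M)
  next
    fix M
    assume "M \<in> spectral_code k n l"
    then obtain v where v: "\<And>s. s < k \<Longrightarrow> frob_compat (v s)"
      and M: "M = mat N n (\<lambda>(r, i). \<Sum>s<k. \<Sum>j\<in>cop_set L.
         v s j * \<beta> ^ (q ^ s * l i * j) * inverse (\<beta> ^ (r * j)))"
      unfolding spectral_code_def by blast
    have "\<exists>c. (\<forall>r<N. c r \<in> prime_subfield) \<and> (\<forall>j\<in>cop_set L. v s j = (\<Sum>r<N. c r * X r j))" if "s < k" for s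
      by (rule frob_compat_expansion[where X = X and v = "v s", OF X ker v[OF that]]) blast+
    then obtain c where c: "\<And>s r. s < k \<Longrightarrow> r < N \<Longrightarrow> c s r \<in> prime_subfield"
      "\<And>s j. s < k \<Longrightarrow> j \<in> cop_set L \<Longrightarrow> v s j = (\<Sum>r<N. c s r * X r j)"
      by metis
    define A where "A s = mat 1 N (\<lambda>(_, r). c s r)" for s
    have A: "A s \<in> carrier_mat 1 N" for s
      by (simp add: A_def)
    have A_entry: "A s $$ (0, t) = c s t" if "t < N" for s t
      using that by (simp add: A_def)
    have "over_prime_subfield (A s)" if "s < k" for s
      unfolding over_prime_subfield_row_iff[OF A] using c that by (simp add: A_entry)
    moreover have "M = mat N n (\<lambda>(r, i). msum 1 N (\<lambda>s. A s * P * (cyclic_mat L ^\<^sub>m (q ^ s * l i)) * Q) {..<k} $$ (0, r))"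
      unfolding M by (intro eq_matI) (simp_all add: code_entry[OF A] c A_entry del: One_nat_def)
    ultimately show "M \<in> circ_shift_code q L k n l P Q"
      unfolding circ_shift_code_def using A by (intro CollectI exI[of _ A]) simp
  qed
qed

text \<open>The change of coordinates is a Vandermonde matrix in the powers of \<beta> with unit
  exponent, with column \<open>j\<close> scaled by the nonzero number
  \<open>poly (tau L \<beta>) (\<beta> ^ j)\<close> divided by \<open>L\<close>.\<close>

lemma tau_code_eq_spectral_code:
  "circ_shift_code q L k n l (leading_id N L)
     (poly_mat (tau L \<beta>) (cyclic_mat L) * (leading_id N L)\<^sup>T) = spectral_code k n l"
proof (rule circ_shift_code_eq_spectral_code)
  show "poly_mat (tau L \<beta>) (cyclic_mat L) * (leading_id N L)\<^sup>T \<in> carrier_mat L N"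
    by (auto simp: poly_mat_spectral intro!: mult_carrier_mat[of _ L L])
next
  fix r j
  have "of_nat L \<in> (prime_subfield :: 'a set)"
    unfolding prime_subfield_def by (metis of_int_of_nat_eq rangeI)
  then show "inverse (of_nat L) * \<beta> ^ (r * (j * q mod L)) * poly (tau L \<beta>) (\<beta> ^ (j * q mod L)) =
      (inverse (of_nat L) * \<beta> ^ (r * j) * poly (tau L \<beta>) (\<beta> ^ j)) ^ q"
    by (simp add: prime_subfield_iff tau_frob mult_q_mod_power power_mult_distrib power_inverse)
next
  fix c :: "nat \<Rightarrow> 'a"
  assume *: "\<And>j. j \<in> cop_set L \<Longrightarrow>
    (\<Sum>r<N. c r * (inverse (of_nat L) * \<beta> ^ (r * j) * poly (tau L \<beta>) (\<beta> ^ j))) = 0"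
  have zero: "(\<Sum>r<N. c r * x ^ r) = 0" if x: "x \<in> (^) \<beta> ` cop_set L" for x
  proof -
    obtain j where j: "j \<in> cop_set L" "x = \<beta> ^ j"
      using x by blast
    have "(\<Sum>r<N. c r * x ^ r) * (inverse (of_nat L) * poly (tau L \<beta>) (\<beta> ^ j)) =
        (\<Sum>r<N. c r * (inverse (of_nat L) * \<beta> ^ (r * j) * poly (tau L \<beta>) (\<beta> ^ j)))"
      by (simp add: j(2) sum_distrib_left sum_distrib_right mult_ac flip: power_mult)
    also have "\<dots> = 0"
      by (rule *[OF j(1)])
    finally show ?thesis
      using tau_nonzero[OF j(1)] L_nonzero by simp
  qed
  have "inj_on ((^) \<beta>) (cop_set L)"
    by (auto simp: inj_on_def cop_set_eq \<beta>_power_inj)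
  then have "N \<le> card ((^) \<beta> ` cop_set L)"
    by (simp add: card_image)
  then show "\<forall>r<N. c r = 0"
    using power_sum_zero_on_imp_zero[OF zero finite_imageI[OF cop_set_finite]] by blast
qed (simp_all add: tau_code_entry)

text \<open>The change of coordinates is \<open>U\<close> on the unit indices. Its kernel is trivial
  because it has an inverse, and it commutes with Frobenius because its inverse does.\<close>

lemma admissible_code_eq_spectral_code:
  assumes "admissible_pair L \<beta> G H" and H: "H = (leading_id N L)\<^sup>T"
  shows "circ_shift_code q L k n l G H = spectral_code k n l"
proof -
  obtain U where UW: "\<And>r c. r < N \<Longrightarrow> c < N \<Longrightarrow>
       (\<Sum>j\<in>cop_set L. U r j * inverse (\<beta> ^ (c * j))) = (if r = c then 1 else 0)"
    and WU: "\<And>i j. i \<in> cop_set L \<Longrightarrow> j \<in> cop_set L \<Longrightarrow>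
       (\<Sum>r<N. inverse (\<beta> ^ (r * i)) * U r j) = (if i = j then 1 else 0)"
    and entry: "\<And>e r c. r < N \<Longrightarrow> c < N \<Longrightarrow>
       (G * (cyclic_mat L ^\<^sub>m e) * H) $$ (r, c) =
       (\<Sum>j\<in>cop_set L. U r j * \<beta> ^ (e * j) * inverse (\<beta> ^ (c * j)))"
    and G: "G \<in> carrier_mat N L"
    using admissible_pair_H_leading_id[OF assms] by blast
  show ?thesis
  proof (rule circ_shift_code_eq_spectral_code[OF G _ entry])
    show "H \<in> carrier_mat L N"
      by (simp add: H)
  next
    fix c :: "nat \<Rightarrow> 'a"
    assume *: "\<And>j. j \<in> cop_set L \<Longrightarrow> (\<Sum>r<N. c r * U r j) = 0"
    show "\<forall>r<N. c r = 0"
    proof (intro allI impI)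
      fix t
      assume t: "t < N"
      have "(\<Sum>j\<in>cop_set L. (\<Sum>r<N. c r * U r j) * inverse (\<beta> ^ (t * j))) =
        (\<Sum>r<N. c r * (\<Sum>j\<in>cop_set L. U r j * inverse (\<beta> ^ (t * j))))"
        unfolding sum_distrib_left sum_distrib_right mult.assoc by (rule sum.swap)
      also have "\<dots> = (\<Sum>r<N. if r = t then c r else 0)"
        using t by (intro sum.cong) (auto simp: UW)
      finally show "c t = 0"
        using t * by simp
    qed
  next
    fix r i
    assume r: "r < N" and i: "i \<in> cop_set L"
    \<comment> \<open>The failure of \<open>U\<close> to commute with Frobenius in row
      \<open>r\<close>; the aim is \<open>d i = 0\<close>.\<close>
    define d where "d j = U r j ^ q - U r (j * q mod L)" for j
    have d_sum: "(\<Sum>j\<in>cop_set L. d j * inverse (\<beta> ^ (c * (j * q mod L)))) = 0" if c: "c < N" for c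
    proof -
      \<comment> \<open>Frobenius is applied to the relation \<open>UW\<close>, whose right-hand
        side 0 or 1 is fixed by it.\<close>
      have "(\<Sum>j\<in>cop_set L. U r j ^ q * inverse (\<beta> ^ (c * (j * q mod L)))) =
          (\<Sum>j\<in>cop_set L. U r j * inverse (\<beta> ^ (c * j))) ^ q"
        by (simp add: frob_sum1 mult_q_mod_power power_mult_distrib power_inverse)
      also have "\<dots> = (\<Sum>j\<in>cop_set L. U r j * inverse (\<beta> ^ (c * j)))"
        using r c prime_gt_0_nat[OF prime_q] by (simp add: UW power_0_left)
      also have "\<dots> = (\<Sum>j\<in>cop_set L. U r (j * q mod L) * inverse (\<beta> ^ (c * (j * q mod L))))"
        by (rule sum.reindex_bij_betw[OF mult_q_mod_bij, symmetric])
      finally show ?thesis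
        by (simp add: d_def left_diff_distrib sum_subtractf)
    qed
    have "i * q mod L \<in> cop_set L"
      using i mult_q_mod_bij by (auto simp: bij_betw_def)
    \<comment> \<open>Pairing with column \<open>i * q mod L\<close> of \<open>U\<close> isolates
      the term \<open>j = i\<close>, by \<open>WU\<close> and injectivity of multiplication by
      \<open>q\<close>.\<close>
    then have "(\<Sum>c<N. (\<Sum>j\<in>cop_set L. d j * inverse (\<beta> ^ (c * (j * q mod L)))) * U c (i * q mod L)) =
      (\<Sum>j\<in>cop_set L. d j * (\<Sum>c<N. inverse (\<beta> ^ (c * (j * q mod L))) * U c (i * q mod L)))"
      unfolding sum_distrib_left sum_distrib_right mult.assoc by (intro sum.swap)
    also have "\<dots> = (\<Sum>j\<in>cop_set L. if j = i then d j else 0)"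
    proof (intro sum.cong refl)
      fix j
      assume "j \<in> cop_set L"
      then have "j * q mod L \<in> cop_set L" "j * q mod L = i * q mod L \<longleftrightarrow> j = i"
        using i mult_q_mod_bij by (auto simp: bij_betw_def inj_on_def)
      then show "d j * (\<Sum>c<N. inverse (\<beta> ^ (c * (j * q mod L))) * U c (i * q mod L)) =
          (if j = i then d j else 0)"
        using WU \<open>i * q mod L \<in> cop_set L\<close> by simp
    qed
    finally have "d i = 0"
      using i cop_set_finite d_sum by simp
    then show "U r (i * q mod L) = U r i ^ q"
      by (simp add: d_def)
  qed
qed

subsection \<open>Cyclotomic cosets and the stacked Gabidulin codes\<close>

text \<open>Since \<open>q\<close> has order \<open>m\<close> modulo \<open>L\<close> and
  \<open>\<epsilon> s\<close> is a unit, the \<open>m\<close> listed residues are distinct. Closure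
  under multiplication by \<open>q\<close> puts them in \<open>Js s\<close>, which has exactly
  \<open>m\<close> elements.\<close>

lemma cyclic_coset:
  assumes part: "coset_partition q L Js \<epsilon>" and s: "s \<in> {1..N div m}"
  shows coset_rep: "\<epsilon> s \<in> cop_set L"
    and coset_bij: "bij_betw (\<lambda>j. \<epsilon> s * q ^ j mod L) {..<m} (Js s)"
proof -
  have Js: "Js s \<subseteq> cop_set L" "card (Js s) = m" "\<And>j. j \<in> Js s \<Longrightarrow> j * q mod L \<in> Js s" "\<epsilon> s \<in> Js s"
    using part s by (auto simp: coset_partition_def)
  show rep: "\<epsilon> s \<in> cop_set L"
    using Js by blast
  have "\<epsilon> s * q ^ j mod L \<in> Js s" for j
  proof (induction j)
    case 0
    then show ?case
      using Js rep by (simp add: cop_set_eq)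
  next
    case (Suc j)
    then show ?case
      using Js(3)[of "\<epsilon> s * q ^ j mod L"] by (simp add: mod_mult_left_eq mod_mult_right_eq mult_ac)
  qed
  moreover have "inj_on (\<lambda>j. \<epsilon> s * q ^ j mod L) {..<m}"
  proof (rule inj_onI)
    fix i j
    assume ij: "i \<in> {..<m}" "j \<in> {..<m}" "\<epsilon> s * q ^ i mod L = \<epsilon> s * q ^ j mod L"
    then have "[q ^ i = q ^ j] (mod L)"
      using rep by (auto simp: cop_set_eq cong_def[symmetric] cong_mult_lcancel_nat)
    then have "[i = j] (mod m)"
      using coprime_q_L by (simp add: order_divides_expdiff coprime_commute)
    then show "i = j"
      using ij by (simp add: cong_less_modulus_unique_nat)
  qed
  moreover have "finite (Js s)"
    using Js cop_set_finite finite_subset by blast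
  ultimately have "(\<lambda>j. \<epsilon> s * q ^ j mod L) ` {..<m} = Js s"
    using Js(2) by (intro card_subset_eq) (auto simp: card_image)
  with \<open>inj_on _ {..<m}\<close> show "bij_betw (\<lambda>j. \<epsilon> s * q ^ j mod L) {..<m} (Js s)"
    by (simp add: bij_betw_def)
qed

text \<open>A unit determines \<open>s\<close> because the cosets are disjoint, and then the
  Frobenius exponent \<open>j\<close> within its coset. These pairs serve as coordinates on the
  units.\<close>

lemma coset_partition_bij:
  assumes part: "coset_partition q L Js \<epsilon>"
  shows "bij_betw (\<lambda>(s, j). \<epsilon> s * q ^ j mod L) ({1..N div m} \<times> {..<m}) (cop_set L)"
proof -
  have img: "(\<lambda>j. \<epsilon> s * q ^ j mod L) ` {..<m} = Js s" if "s \<in> {1..N div m}" for s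
    using coset_bij[OF part that] by (simp add: bij_betw_def)
  have "inj_on (\<lambda>(s, j). \<epsilon> s * q ^ j mod L) ({1..N div m} \<times> {..<m})"
  proof (rule inj_onI)
    fix x y
    assume xy: "x \<in> {1..N div m} \<times> {..<m}" "y \<in> {1..N div m} \<times> {..<m}"
      "(\<lambda>(s, j). \<epsilon> s * q ^ j mod L) x = (\<lambda>(s, j). \<epsilon> s * q ^ j mod L) y"
    obtain s i t j where eq: "x = (s, i)" "y = (t, j)"
      by (cases x, cases y)
    have *: "s \<in> {1..N div m}" "i \<in> {..<m}" "t \<in> {1..N div m}" "j \<in> {..<m}"
      "\<epsilon> s * q ^ i mod L = \<epsilon> t * q ^ j mod L"
      using xy by (simp_all add: eq)
    have "\<epsilon> s * q ^ i mod L \<in> Js s" "\<epsilon> t * q ^ j mod L \<in> Js t"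
      using imageI[OF *(2), of "\<lambda>j. \<epsilon> s * q ^ j mod L"] imageI[OF *(4), of "\<lambda>j. \<epsilon> t * q ^ j mod L"]
      unfolding img[OF *(1)] img[OF *(3)] by simp_all
    then have "\<epsilon> s * q ^ i mod L \<in> Js s \<inter> Js t"
      using *(5) by simp
    moreover have "disjoint_family_on Js {1..N div m}"
      using part by (simp add: coset_partition_def)
    ultimately have "s = t"
      using *(1,3) unfolding disjoint_family_on_def by blast
    then show "x = y"
      using * coset_bij[OF part *(1)] by (auto simp: eq bij_betw_def inj_on_def)
  qed
  moreover have "(\<lambda>(s, j). \<epsilon> s * q ^ j mod L) ` ({1..N div m} \<times> {..<m}) =
      (\<Union>s\<in>{1..N div m}. (\<lambda>j. \<epsilon> s * q ^ j mod L) ` {..<m})"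
    by auto
  ultimately show ?thesis
    using part img by (simp add: bij_betw_def coset_partition_def)
qed

section \<open>Bases and independent families over the prime subfield\<close>

text \<open>A linear relation gives a polynomial of degree below \<open>m\<close> over the prime
  subfield that vanishes at \<open>\<beta> ^ (L - \<epsilon> s)\<close>, hence at its
  \<open>m\<close> distinct conjugates, so it is zero. The combinations are then
  \<open>q ^ m\<close> distinct elements and fill the field.\<close>

lemma basis_family_B_fam:
  assumes "\<epsilon> s \<in> cop_set L"
  shows "basis_family (B_fam q L \<beta> \<epsilon> i s)"
proof -
  let ?e = "L - \<epsilon> s"
  define A where "A = (\<lambda>j. \<beta> ^ (?e * q ^ j)) ` {..<m}"
  let ?B = "\<lambda>r. \<beta> ^ (((i - 1) * m + r) * ?e)"
  have "coprime ?e L"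
  proof (rule coprimeI)
    fix c
    assume c: "c dvd ?e" "c dvd L"
    then have "c dvd L - ?e"
      by (simp add: dvd_diff_nat)
    then show "is_unit c"
      using assms c(2) coprime_common_divisor[of "\<epsilon> s" L c] by (simp add: cop_set_eq)
  qed
  then have inj: "inj_on (\<lambda>j. \<beta> ^ (?e * q ^ j)) {..<m}"
    using coprime_q_L
    by (auto simp: inj_on_def \<beta>_power_eq_iff cong_mult_lcancel_nat order_divides_expdiff
        coprime_commute[of L] cong_less_modulus_unique_nat)
  have indep: "\<forall>r<m. a r = 0"
    if a: "\<forall>r<m. a r \<in> prime_subfield" and zero: "(\<Sum>r<m. a r * ?B r) = 0" for a
  proof -
    \<comment> \<open>The block index \<open>i\<close> contributes only a common nonzero
      factor.\<close>
    have "(\<Sum>r<m. a r * ?B r) = \<beta> ^ ((i - 1) * m * ?e) * (\<Sum>r<m. a r * (\<beta> ^ ?e) ^ r)"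
      by (simp add: sum_distrib_left add_mult_distrib add_mult_distrib2 power_add mult_ac flip: power_mult)
    then have base: "(\<Sum>r<m. a r * (\<beta> ^ ?e) ^ r) = 0"
      using zero \<beta>_nonzero by simp
    have zero: "(\<Sum>r<m. a r * x ^ r) = 0" if x: "x \<in> A" for x
    proof -
      obtain j where j: "x = (\<beta> ^ ?e) ^ q ^ j"
        using x by (auto simp: A_def power_mult)
      have "(\<Sum>r<m. a r * (\<beta> ^ ?e) ^ r) ^ q ^ j = (\<Sum>r<m. a r ^ q ^ j * ((\<beta> ^ ?e) ^ r) ^ q ^ j)"
        by (simp add: frob_sum power_mult_distrib)
      also have "\<dots> = (\<Sum>r<m. a r * x ^ r)"
        using a by (intro sum.cong refl)
          (simp add: j frob_fixed_power prime_subfield_iff mult_ac flip: power_mult)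
      finally show ?thesis
        using base prime_gt_0_nat[OF prime_q] by (simp add: power_0_left)
    qed
    have "finite A" "m \<le> card A"
      using inj by (simp_all add: A_def card_image)
    then show ?thesis
      using power_sum_zero_on_imp_zero[OF zero] by blast
  qed
  then have "lin_indep_family (B_fam q L \<beta> \<epsilon> i s)"
    by (simp add: lin_indep_family_def B_fam_def)
  moreover have "\<exists>a. (\<forall>r<m. a r \<in> prime_subfield) \<and> x = (\<Sum>r<m. a r * ?B r)" for x
  proof -
    let ?D = "{..<m} \<rightarrow>\<^sub>E (prime_subfield :: 'a set)"
    define T where "T a = (\<Sum>r<m. a r * ?B r)" for a
    have "inj_on T ?D"
    proof (rule inj_onI)
      fix a b
      assume ab: "a \<in> ?D" "b \<in> ?D" "T a = T b"
      have "a r - b r \<in> prime_subfield" if "r < m" for r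
        using ab that by (auto simp: PiE_iff prime_subfield_iff frob_diff)
      moreover have "(\<Sum>r<m. (a r - b r) * ?B r) = 0"
        using ab(3) by (simp add: T_def left_diff_distrib sum_subtractf)
      ultimately have "\<forall>r<m. a r - b r = 0"
        by (intro indep) auto
      then show "a = b"
        using ab by (intro PiE_ext[of a "{..<m}" "\<lambda>_. prime_subfield" b]) auto
    qed
    then have "card (T ` ?D) = card (UNIV :: 'a set)"
      by (simp add: card_image card_funcsetE card_prime_subfield card_field)
    then have "T ` ?D = UNIV"
      by (intro card_subset_eq) auto
    then obtain a where "a \<in> ?D" "x = T a"
      by blast
    then show ?thesis
      by (auto simp: T_def)
  qed
  ultimately show ?thesis
    by (simp add: basis_family_def B_fam_def)
qed

text \<open>A nontrivial relation makes the eigenvalue at index \<open>\<epsilon> s\<close> of the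
  corresponding combination of shift powers vanish. The matrix in the rank condition is then
  singular, contradicting full rank.\<close>

lemma lin_indep_F_fam:
  assumes adm: "admissible_pair L \<beta> G H" "H = (leading_id N L)\<^sup>T"
    and mrd: "mrd_exponents L n l G H" and rep: "\<epsilon> s \<in> cop_set L"
  shows "lin_indep_family (F_fam n \<beta> \<epsilon> l s)"
proof -
  obtain U where "\<And>r c. r < N \<Longrightarrow> c < N \<Longrightarrow>
       (\<Sum>j\<in>cop_set L. U r j * inverse (\<beta> ^ (c * j))) = (if r = c then 1 else 0)"
    and WU: "\<And>i j. i \<in> cop_set L \<Longrightarrow> j \<in> cop_set L \<Longrightarrow>
       (\<Sum>r<N. inverse (\<beta> ^ (r * i)) * U r j) = (if i = j then 1 else 0)"
    and entry: "\<And>e r c. r < N \<Longrightarrow> c < N \<Longrightarrow>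
       (G * (cyclic_mat L ^\<^sub>m e) * H) $$ (r, c) =
       (\<Sum>j\<in>cop_set L. U r j * \<beta> ^ (e * j) * inverse (\<beta> ^ (c * j)))"
    and G: "G \<in> carrier_mat N L"
    using admissible_pair_H_leading_id[OF adm] by blast
  have H: "H \<in> carrier_mat L N"
    by (simp add: adm)
  have nonzero: "(\<Sum>i<n. a i * \<beta> ^ (\<epsilon> s * l i)) \<noteq> 0"
    if a: "\<forall>i<n. a i \<in> prime_subfield" "\<exists>i<n. a i \<noteq> 0" for a
  proof
    assume zero: "(\<Sum>i<n. a i * \<beta> ^ (\<epsilon> s * l i)) = 0"
    define M where "M = msum N N (\<lambda>i. a i \<cdot>\<^sub>m (G * (cyclic_mat L ^\<^sub>m l i) * H)) {..<n}"
    define g where "g j = (\<Sum>i<n. a i * \<beta> ^ (l i * j))" for j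
    have M: "M \<in> carrier_mat N N"
      by (simp add: M_def msum_def)
    have "vec_space.rank N M = N"
      using mrd a by (simp add: mrd_exponents_def M_def)
    then have "det M \<noteq> 0"
      using vec_space.det_rank_iff[OF M] by simp
    moreover have M_entry: "M $$ (r, c) = (\<Sum>j\<in>cop_set L. U r j * g j * inverse (\<beta> ^ (c * j)))"
      if "r < N" "c < N" for r c
    proof -
      have "M $$ (r, c) = (\<Sum>i<n. a i * (\<Sum>j\<in>cop_set L. U r j * \<beta> ^ (l i * j) * inverse (\<beta> ^ (c * j))))"
        using that G H entry by (simp add: M_def msum_def)
      also have "\<dots> = (\<Sum>j\<in>cop_set L. \<Sum>i<n. a i * (U r j * \<beta> ^ (l i * j) * inverse (\<beta> ^ (c * j))))"
        unfolding sum_distrib_left by (rule sum.swap)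
      finally show ?thesis
        by (simp add: g_def sum_distrib_left sum_distrib_right mult_ac)
    qed
    \<comment> \<open>Column \<open>\<epsilon> s\<close> of \<open>U\<close>: by \<open>WU\<close>
      it picks out the eigencomponent whose eigenvalue \<open>g (\<epsilon> s)\<close> is
      zero.\<close>
    define x where "x = vec N (\<lambda>c. U c (\<epsilon> s))"
    have "M *\<^sub>v x = 0\<^sub>v N"
    proof (rule eq_vecI)
      fix r
      assume "r < dim_vec (0\<^sub>v N :: 'a vec)"
      then have r: "r < N"
        by simp
      have "(M *\<^sub>v x) $ r = (\<Sum>c<N. (\<Sum>j\<in>cop_set L. U r j * g j * inverse (\<beta> ^ (c * j))) * U c (\<epsilon> s))"
        using r M by (simp add: x_def scalar_prod_def M_entry lessThan_atLeast0)
      also have "\<dots> = (\<Sum>j\<in>cop_set L. U r j * g j * (\<Sum>c<N. inverse (\<beta> ^ (c * j)) * U c (\<epsilon> s)))"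
        unfolding sum_distrib_left sum_distrib_right mult.assoc by (rule sum.swap)
      also have "\<dots> = (\<Sum>j\<in>cop_set L. U r j * g j * (if j = \<epsilon> s then 1 else 0))"
        using rep by (intro sum.cong refl) (simp add: WU)
      also have "\<dots> = 0"
        using zero by (intro sum.neutral) (simp add: g_def mult.commute[of "\<epsilon> s"])
      finally show "(M *\<^sub>v x) $ r = 0\<^sub>v N $ r"
        using r by simp
    qed (use M in simp)
    moreover have "x \<noteq> 0\<^sub>v N"
    proof
      assume "x = 0\<^sub>v N"
      then have "U c (\<epsilon> s) = 0" if "c < N" for c
        using that unfolding x_def by (metis index_vec index_zero_vec(1))
      then show False
        using WU[OF rep rep] by simp
    qed
    moreover have "x \<in> carrier_vec N"
      by (simp add: x_def)
    ultimately show False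
      using det_0_iff_vec_prod_zero_field[OF M] by blast
  qed
  show ?thesis
    using nonzero by (auto simp: lin_indep_family_def F_fam_def)
qed

section \<open>Spectral form of the stacked Gabidulin codes\<close>

text \<open>Column \<open>j\<close> of \<open>M_o\<close> and row \<open>j\<close> of
  \<open>L_mat\<close> carry the \<open>j\<close>-th Frobenius conjugates, so summing over
  \<open>s\<close> and \<open>j\<close> is summing over all units. The spectrum at
  \<open>pos (\<sigma>, j)\<close> is the power \<open>q ^ j\<close> of the coefficient attached to
  coset \<sigma>.\<close>

lemma M_tilde_eq_spectral_code:
  assumes part: "coset_partition q L Js \<epsilon>"
  shows "M_tilde q L k n (B_fam q L \<beta> \<epsilon>) (F_fam n \<beta> \<epsilon> l) = spectral_code k n l"
proof -
  let ?S = "{1..N div m}"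
  define pos where "pos = (\<lambda>(s, j). \<epsilon> s * q ^ j mod L)"
  have pos: "bij_betw pos (?S \<times> {..<m}) (cop_set L)"
    unfolding pos_def by (rule coset_partition_bij[OF part])
  have pos_Suc: "pos (\<sigma>, j) * q mod L = pos (\<sigma>, Suc j)" for \<sigma> j
    by (simp add: pos_def mod_mult_left_eq mod_mult_right_eq mult_ac)
  have rep: "\<epsilon> \<sigma> < L" if "\<sigma> \<in> ?S" for \<sigma>
    using coset_rep[OF part that] by (simp add: cop_set_eq)
  have pos_0: "pos (\<sigma>, 0) = \<epsilon> \<sigma>" if "\<sigma> \<in> ?S" for \<sigma>
    using rep[OF that] by (simp add: pos_def)
  have pos_m: "pos (\<sigma>, m) = pos (\<sigma>, 0)" for \<sigma>
  proof -
    have "[q ^ m = 1] (mod L)"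
      using ord_works by blast
    then have "[\<epsilon> \<sigma> * q ^ m = \<epsilon> \<sigma> * 1] (mod L)"
      by (rule cong_scalar_left)
    then show ?thesis
      by (simp add: pos_def cong_def)
  qed
  \<comment> \<open>Modulo \<open>L\<close>, the exponent \<open>L - \<epsilon> \<sigma>\<close>
    stands for the negative of \<open>\<epsilon> \<sigma>\<close>, which produces the inverse powers
    of the spectral form.\<close>
  have B_entry: "(\<beta> ^ (r * (L - \<epsilon> \<sigma>))) ^ q ^ j = inverse (\<beta> ^ (r * pos (\<sigma>, j)))"
    if "\<sigma> \<in> ?S" for r \<sigma> j
  proof -
    have "\<beta> ^ (r * (L - \<epsilon> \<sigma>) * q ^ j) * \<beta> ^ (r * pos (\<sigma>, j)) = \<beta> ^ (r * (L - \<epsilon> \<sigma>) * q ^ j) * \<beta> ^ (r * (\<epsilon> \<sigma> * q ^ j))"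
      by (intro arg_cong2[where f = "(*)"] \<beta>_cong refl) (simp add: pos_def cong_def mod_mult_right_eq)
    also have "\<dots> = \<beta> ^ (r * q ^ j * ((L - \<epsilon> \<sigma>) + \<epsilon> \<sigma>))"
      by (simp add: add_mult_distrib2 power_add mult_ac)
    also have "\<dots> = 1"
      using rep[OF that] by (simp add: \<beta>_power_eq_1_iff)
    finally show ?thesis
      unfolding power_mult[symmetric] by (metis inverse_unique mult.commute)
  qed
  have F_entry: "((\<beta> ^ (\<epsilon> \<sigma> * e)) ^ q ^ s) ^ q ^ j = \<beta> ^ (q ^ s * e * pos (\<sigma>, j))" for \<sigma> e s j
  proof -
    have "[q ^ s * e * pos (\<sigma>, j) = q ^ s * e * (\<epsilon> \<sigma> * q ^ j)] (mod L)"
      by (intro cong_scalar_left) (simp add: pos_def cong_def)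
    then have "\<beta> ^ (q ^ s * e * pos (\<sigma>, j)) = \<beta> ^ (q ^ s * e * (\<epsilon> \<sigma> * q ^ j))"
      by (rule \<beta>_cong)
    then show ?thesis
      by (simp add: mult_ac flip: power_mult)
  qed
  \<comment> \<open>Stated for every \<open>v\<close> that matches \<Lambda> on the cosets, so that
    both inclusions can use it.\<close>
  have entry: "msum m n (\<lambda>\<sigma>. M_o q (B_fam q L \<beta> \<epsilon> (\<rho> div m + 1) \<sigma>) *
        L_mat q m (F_fam n \<beta> \<epsilon> l \<sigma>) (\<Lambda> \<sigma>)) ?S $$ (\<rho> mod m, t) =
      (\<Sum>s<k. \<Sum>j\<in>cop_set L. v s j * \<beta> ^ (q ^ s * l t * j) * inverse (\<beta> ^ (\<rho> * j)))"
    if \<Lambda>: "\<And>\<sigma>. \<sigma> \<in> ?S \<Longrightarrow> \<Lambda> \<sigma> \<in> carrier_vec k"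
      and v: "\<And>s \<sigma> j. s < k \<Longrightarrow> \<sigma> \<in> ?S \<Longrightarrow> j < m \<Longrightarrow> v s (pos (\<sigma>, j)) = (\<Lambda> \<sigma> $ s) ^ q ^ j"
      and t: "t < n" for \<Lambda> v \<rho> t
  proof -
    define h where "h s j = v s j * \<beta> ^ (q ^ s * l t * j) * inverse (\<beta> ^ (\<rho> * j))" for s j
    have "msum m n (\<lambda>\<sigma>. M_o q (B_fam q L \<beta> \<epsilon> (\<rho> div m + 1) \<sigma>) *
        L_mat q m (F_fam n \<beta> \<epsilon> l \<sigma>) (\<Lambda> \<sigma>)) ?S $$ (\<rho> mod m, t) =
      (\<Sum>\<sigma>\<in>?S. \<Sum>j<m. (\<beta> ^ (\<rho> * (L - \<epsilon> \<sigma>))) ^ q ^ j *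
        poly (lin_poly q (\<Lambda> \<sigma>)) (\<beta> ^ (\<epsilon> \<sigma> * l t)) ^ q ^ j)"
      \<comment> \<open>The block number \<open>\<rho> div m + 1\<close> meets the
        \<open>i - 1\<close> in \<open>B_fam\<close>, so offset and local row recombine to the
        global row \<rho>.\<close>
      using m_pos t
      by (simp add: msum_def scalar_prod_def div_mult_mod_eq[of \<rho> m] M_o_def B_fam_def L_mat_def F_fam_def lessThan_atLeast0)
    also have "\<dots> = (\<Sum>\<sigma>\<in>?S. \<Sum>j<m. \<Sum>s<k. h s (pos (\<sigma>, j)))"
    proof (intro sum.cong refl)
      fix \<sigma> j
      assume \<sigma>: "\<sigma> \<in> ?S" and j: "j \<in> {..<m}"
      have "poly (lin_poly q (\<Lambda> \<sigma>)) (\<beta> ^ (\<epsilon> \<sigma> * l t)) ^ q ^ j =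
          (\<Sum>s<k. (\<Lambda> \<sigma> $ s) ^ q ^ j * ((\<beta> ^ (\<epsilon> \<sigma> * l t)) ^ q ^ s) ^ q ^ j)"
        using \<Lambda>[OF \<sigma>] by (simp add: lin_poly_def poly_sum poly_monom frob_sum power_mult_distrib)
      also have "\<dots> = (\<Sum>s<k. v s (pos (\<sigma>, j)) * \<beta> ^ (q ^ s * l t * pos (\<sigma>, j)))"
        using v \<sigma> j by (intro sum.cong refl) (simp add: F_entry)
      finally show "(\<beta> ^ (\<rho> * (L - \<epsilon> \<sigma>))) ^ q ^ j *
          poly (lin_poly q (\<Lambda> \<sigma>)) (\<beta> ^ (\<epsilon> \<sigma> * l t)) ^ q ^ j = (\<Sum>s<k. h s (pos (\<sigma>, j)))"
        using B_entry[OF \<sigma>] by (simp add: h_def sum_distrib_left mult_ac)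
    qed
    also have "\<dots> = (\<Sum>x\<in>?S \<times> {..<m}. \<Sum>s<k. h s (pos x))"
      by (subst sum.cartesian_product) (simp add: case_prod_unfold)
    also have "\<dots> = (\<Sum>j\<in>cop_set L. \<Sum>s<k. h s j)"
      by (rule sum.reindex_bij_betw[OF pos])
    also have "\<dots> = (\<Sum>s<k. \<Sum>j\<in>cop_set L. h s j)"
      by (rule sum.swap)
    finally show ?thesis
      by (simp add: h_def)
  qed
  show ?thesis
  proof (intro equalityI subsetI)
    fix M
    assume "M \<in> M_tilde q L k n (B_fam q L \<beta> \<epsilon>) (F_fam n \<beta> \<epsilon> l)"
    then obtain \<Lambda> where \<Lambda>: "\<And>\<sigma>. \<sigma> \<in> ?S \<Longrightarrow> \<Lambda> \<sigma> \<in> carrier_vec k"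
      and M: "M = mat N n (\<lambda>(\<rho>, t). msum m n (\<lambda>\<sigma>. M_o q (B_fam q L \<beta> \<epsilon> (\<rho> div m + 1) \<sigma>) *
        L_mat q m (F_fam n \<beta> \<epsilon> l \<sigma>) (\<Lambda> \<sigma>)) ?S $$ (\<rho> mod m, t))"
      unfolding M_tilde_def by blast
    \<comment> \<open>The coefficients at the representatives are spread over each coset by
      Frobenius, with \<open>pos\<close> inverted to find the coset and exponent.\<close>
    define v where "v s x = (case the_inv_into (?S \<times> {..<m}) pos x of (\<sigma>, j) \<Rightarrow> (\<Lambda> \<sigma> $ s) ^ q ^ j)" for s x
    have v: "v s (pos (\<sigma>, j)) = (\<Lambda> \<sigma> $ s) ^ q ^ j" if "\<sigma> \<in> ?S" "j < m" for s \<sigma> j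
      using that pos the_inv_into_f_f[of pos "?S \<times> {..<m}" "(\<sigma>, j)"]
      by (simp add: v_def bij_betw_def)
    show "M \<in> spectral_code k n l"
    proof (rule spectral_codeI)
      fix s
      show "frob_compat (v s)"
        unfolding frob_compat_def
      proof
        fix x
        assume "x \<in> cop_set L"
        then have "x \<in> pos ` (?S \<times> {..<m})"
          using pos by (simp add: bij_betw_def)
        then obtain \<sigma> j where x: "x = pos (\<sigma>, j)" "\<sigma> \<in> ?S" "j < m"
          by blast
        have pow: "v s x ^ q = (\<Lambda> \<sigma> $ s) ^ q ^ Suc j"
          using x by (simp add: v mult.commute flip: power_mult)
        show "v s (x * q mod L) = v s x ^ q"
        proof (cases "Suc j < m")
          case True
          then show ?thesis
            unfolding pow using x v by (simp add: pos_Suc)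
        next
          \<comment> \<open>The wrap-around at the end of a coset: the position returns to the
            representative, and the power \<open>q ^ m\<close> is the identity on the field.\<close>
          case False
          then have "Suc j = m"
            using x by simp
          then show ?thesis
            unfolding pow using x v[of \<sigma> 0] m_pos by (simp only: pos_Suc pos_m power_card) simp
        qed
      qed
    next
      fix r i
      assume "r < N" "i < n"
      then show "M $$ (r, i) = (\<Sum>s<k. \<Sum>j\<in>cop_set L.
         v s j * \<beta> ^ (q ^ s * l i * j) * inverse (\<beta> ^ (r * j)))"
        using entry[OF \<Lambda>, where v = v] v by (simp add: M)
    qed (simp add: M)
  next
    fix M
    assume "M \<in> spectral_code k n l"
    then obtain v where compat: "\<And>s. s < k \<Longrightarrow> frob_compat (v s)"
      and M: "M = mat N n (\<lambda>(r, i). \<Sum>s<k. \<Sum>j\<in>cop_set L.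
         v s j * \<beta> ^ (q ^ s * l i * j) * inverse (\<beta> ^ (r * j)))"
      unfolding spectral_code_def by blast
    \<comment> \<open>Only the values at the representatives are kept; compatibility recovers the
      others.\<close>
    define \<Lambda> where "\<Lambda> \<sigma> = vec k (\<lambda>s. v s (\<epsilon> \<sigma>))" for \<sigma>
    have \<Lambda>: "\<Lambda> \<sigma> \<in> carrier_vec k" for \<sigma>
      by (simp add: \<Lambda>_def)
    have v: "v s (pos (\<sigma>, j)) = (\<Lambda> \<sigma> $ s) ^ q ^ j" if "s < k" "\<sigma> \<in> ?S" "j < m" for s \<sigma> j
      using that(3)
    proof (induction j)
      case 0
      then show ?case
        using that pos_0 by (simp add: \<Lambda>_def)
    next
      case (Suc j)
      then have "pos (\<sigma>, j) \<in> cop_set L"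
        using that pos by (auto simp: bij_betw_def)
      then have "v s (pos (\<sigma>, Suc j)) = v s (pos (\<sigma>, j)) ^ q"
        using compat[OF that(1)] by (simp add: frob_compat_def flip: pos_Suc)
      then show ?case
        using Suc by (simp add: mult.commute flip: power_mult)
    qed
    have "M = mat N n (\<lambda>(\<rho>, t). msum m n (\<lambda>\<sigma>. M_o q (B_fam q L \<beta> \<epsilon> (\<rho> div m + 1) \<sigma>) *
        L_mat q m (F_fam n \<beta> \<epsilon> l \<sigma>) (\<Lambda> \<sigma>)) ?S $$ (\<rho> mod m, t))"
      unfolding M using entry[OF \<Lambda> v] by (intro eq_matI) simp_all
    then show "M \<in> M_tilde q L k n (B_fam q L \<beta> \<epsilon>) (F_fam n \<beta> \<epsilon> l)"
      unfolding M_tilde_def using \<Lambda> by blast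
  qed
qed

end

section \<open>Equality of the three codes, with the basis and independence claims\<close>

theorem theorem16:
  fixes q L k n d :: nat
    and \<beta> :: "'a :: {field, finite}"
    and l \<epsilon> :: "nat \<Rightarrow> nat"
    and Js :: "nat \<Rightarrow> nat set"
    and G1 H1 G2 H2 :: "'a mat"
  assumes "prime q" and "L > 0" and "gcd q L = 1"
    and "card (UNIV :: 'a set) = q ^ ord L q"
    and "primitive_root_of_unity L \<beta>"
    and "1 \<le> k" and "k \<le> n" and "n \<le> ord L q" and "ord L q \<le> cop_card L"
    and "coset_partition q L Js \<epsilon>"
    and "\<forall>i<n. l i \<le> L - 1" and "inj_on l {..<n}"
    and "admissible_pair L \<beta> G1 H1" and "H1 = (leading_id (cop_card L) L)\<^sup>T"
    and "admissible_pair L \<beta> G2 H2" and "G2 = leading_id (cop_card L) L"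
    and "circ_shift_mrd_code q L k n l G1 H1 d"
    and "circ_shift_mrd_code q L k n l G2 (poly_mat (tau L \<beta>) (cyclic_mat L) * G2\<^sup>T) d"
  shows "(\<forall>i\<in>{1..cop_card L div ord L q}. \<forall>s\<in>{1..cop_card L div ord L q}.
            basis_family (B_fam q L \<beta> \<epsilon> i s))
       \<and> (\<forall>s\<in>{1..cop_card L div ord L q}. lin_indep_family (F_fam n \<beta> \<epsilon> l s))
       \<and> circ_shift_code q L k n l G1 H1
          = circ_shift_code q L k n l G2 (poly_mat (tau L \<beta>) (cyclic_mat L) * G2\<^sup>T)
       \<and> circ_shift_code q L k n l G2 (poly_mat (tau L \<beta>) (cyclic_mat L) * G2\<^sup>T)
          = M_tilde q L k n (B_fam q L \<beta> \<epsilon>) (F_fam n \<beta> \<epsilon> l)"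
proof -
  \<comment> \<open>The chain from \<open>1 \<le> k\<close> up to \<open>cop_card L\<close> makes
    the set of units nonempty, which excludes \<open>L = 1\<close>.\<close>
  have "cop_set 1 = {}"
    by (auto simp: cop_set_def)
  then have "L \<noteq> 1"
    using assms(6-9) by auto
  then interpret cyclic_field q L \<beta>
  proof unfold_locales
    show "1 < L"
      using assms(2) \<open>L \<noteq> 1\<close> by simp
    show "coprime q L"
      using assms(3) by (simp only: coprime_iff_gcd_eq_1)
  qed (rule assms)+
  have "mrd_exponents L n l G1 H1"
    using assms(17) by (simp add: circ_shift_mrd_code_def)
  then have "\<forall>s\<in>{1..cop_card L div ord L q}. lin_indep_family (F_fam n \<beta> \<epsilon> l s)"
    using lin_indep_F_fam[OF assms(13,14)] coset_rep[OF assms(10)] by blast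
  moreover have "\<forall>i\<in>{1..cop_card L div ord L q}. \<forall>s\<in>{1..cop_card L div ord L q}.
      basis_family (B_fam q L \<beta> \<epsilon> i s)"
    using basis_family_B_fam coset_rep[OF assms(10)] by blast
  ultimately show ?thesis
    unfolding assms(16) tau_code_eq_spectral_code M_tilde_eq_spectral_code[OF assms(10)]
      admissible_code_eq_spectral_code[OF assms(13,14)]
    by blast
qed

end
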